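(* Let $G$ be a countable sofic group. Let $(X,\mu)$ be a standard probability space with $H(\mu)=+\infty$, and let $G$ act on $(X^G,\mu^G)$ by the Bernoulli action. Then there is no generating countable measurable partition $\mathcal Q$ of $X^G$ such that $H_{\mu^G}(\mathcal Q)<+\infty$.
   Context: A standard probability space is a standard Borel space with a Borel probability measure (atoms allowed). **Sofic group.** $\mathrm{Sym}(d)$ is the permutation group of $\{1,\dots,d\}$. A countable group $G$ is sofic if it admits a sofic approximation sequence, i.e. a sequence of maps (not necessarily homomorphisms) $\sigma_i:G\to\mathrm{Sym}(d_i)$, written $s\mapsto\sigma_{i,s}$, with $d_i$ positive integers, $d_i\to\infty$, such that $\lim_{i\to\infty}\frac1{d_i}|\{k:\sigma_{i,st}(k)=\sigma_{i,s}\sigma_{i,t}(k)\}|=1$ for all $s,t\in G$, and $\lim_{i\to\infty}\frac1{d_i}|\{k:\sigma_{i,s}(k)\neq\sigma_{i,t}(k)\}|=1$ for all distinct $s,t\in G$. **Bernoulli action.** $X^G$ carries the product Borel structure and product measure $\mu^G$, and $G$ acts by $g\cdot(x_h)_{h\in G}=(x_{g^{-1}h})_{h\in G}$. **Entropy.** For a countable measurable partition $\mathcal Q$ of a probability space $(Z,\lambda)$, $H_\lambda(\mathcal Q)=-\sum_{Q\in\mathcal Q}\lambda(Q)\log\lambda(Q)\in[0,+\infty]$ (with $0\log0=0$). $H(\mu)\in[0,+\infty]$ is the supremum of $H_\mu(\mathcal Q)$ over all finite measurable partitions $\mathcal Q$ of $X$. **Generating partition.** For a measure-preserving action of $G$ on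 $(Z,\lambda)$, a countable measurable partition $\mathcal Q$ of $Z$ is generating if the smallest $G$-invariant $\sigma$-algebra containing $\mathcal Q$ coincides, modulo $\lambda$-null sets, with the $\sigma$-algebra of all measurable sets. *)

theory Defs
  imports "HOL-Probability.Probability" "HOL-Algebra.Sym_Groups"
begin

text \<open>
  A standard Borel space is a measurable space whose sigma-algebra is the Borel
  sigma-algebra of some Polish topology on it.
\<close>

definition standard_borel :: "'a measure \<Rightarrow> bool" where
  "standard_borel M \<longleftrightarrow>
    (\<exists>T. completely_metrizable_space T \<and> separable_space T \<and> topspace T = space M \<and>
         sets M = sigma_sets (topspace T) {U. openin T U})"

definition standard_prob_space :: "'a measure \<Rightarrow> bool" where
  "standard_prob_space M \<longleftrightarrow> prob_space M \<and> standard_borel M"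

definition sofic_approximation ::
  "('g, 'm) monoid_scheme \<Rightarrow> (nat \<Rightarrow> nat) \<Rightarrow> (nat \<Rightarrow> 'g \<Rightarrow> nat \<Rightarrow> nat) \<Rightarrow> bool" where
  "sofic_approximation G d \<sigma> \<longleftrightarrow>
    (\<forall>i. 0 < d i) \<and> filterlim d at_top sequentially \<and>
    (\<forall>i. \<forall>s\<in>carrier G. \<sigma> i s \<in> carrier (sym_group (d i))) \<and>
    (\<forall>s\<in>carrier G. \<forall>t\<in>carrier G.
      (\<lambda>i. real (card {k\<in>{1..d i}. \<sigma> i (s \<otimes>\<^bsub>G\<^esub> t) k = \<sigma> i s (\<sigma> i t k)}) / real (d i))
        \<longlonglongrightarrow> 1) \<and>
    (\<forall>s\<in>carrier G. \<forall>t\<in>carrier G. s \<noteq> t \<longrightarrow>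
      (\<lambda>i. real (card {k\<in>{1..d i}. \<sigma> i s k \<noteq> \<sigma> i t k}) / real (d i)) \<longlonglongrightarrow> 1)"

definition sofic :: "('g, 'm) monoid_scheme \<Rightarrow> bool" where
  "sofic G \<longleftrightarrow> (\<exists>d \<sigma>. sofic_approximation G d \<sigma>)"

text \<open>
  Points of the product are functions that are \<^const>\<open>undefined\<close> outside
  \<^term>\<open>carrier G\<close>, as usual for \<^const>\<open>PiM\<close>.
\<close>

definition bernoulli_space :: "('g, 'm) monoid_scheme \<Rightarrow> 'a measure \<Rightarrow> ('g \<Rightarrow> 'a) measure" where
  "bernoulli_space G M = PiM (carrier G) (\<lambda>_. M)"

definition bernoulli_action :: "('g, 'm) monoid_scheme \<Rightarrow> 'g \<Rightarrow> ('g \<Rightarrow> 'a) \<Rightarrow> ('g \<Rightarrow> 'a)" where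
  "bernoulli_action G g x = (\<lambda>h\<in>carrier G. x (inv\<^bsub>G\<^esub> g \<otimes>\<^bsub>G\<^esub> h))"

definition countable_measurable_partition :: "'z measure \<Rightarrow> 'z set set \<Rightarrow> bool" where
  "countable_measurable_partition N Q \<longleftrightarrow> countable Q \<and> Q \<subseteq> sets N \<and> partition_on (space N) Q"

text \<open>
  The summands are nonnegative when \<^term>\<open>N\<close> is a probability space, so \<^const>\<open>ennreal\<close>
  truncates nothing; \<^prop>\<open>ln 0 = (0::real)\<close> covers the null pieces.
\<close>

definition partition_entropy :: "'z measure \<Rightarrow> 'z set set \<Rightarrow> ennreal" where
  "partition_entropy N Q = (\<Sum>\<^sub>\<infinity>A\<in>Q. ennreal (- (measure N A * ln (measure N A))))"

definition space_entropy :: "'z measure \<Rightarrow> ennreal" where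
  "space_entropy N =
    (SUP Q \<in> {Q. finite Q \<and> countable_measurable_partition N Q}. partition_entropy N Q)"

definition invariant_sigma_algebra ::
  "('g, 'm) monoid_scheme \<Rightarrow> ('g \<Rightarrow> 'z \<Rightarrow> 'z) \<Rightarrow> 'z set \<Rightarrow> 'z set set \<Rightarrow> bool" where
  "invariant_sigma_algebra G act Z F \<longleftrightarrow>
    sigma_algebra Z F \<and> (\<forall>g\<in>carrier G. \<forall>A\<in>F. act g ` A \<in> F)"

definition generated_invariant_sigma_algebra ::
  "('g, 'm) monoid_scheme \<Rightarrow> ('g \<Rightarrow> 'z \<Rightarrow> 'z) \<Rightarrow> 'z set \<Rightarrow> 'z set set \<Rightarrow> 'z set set" where
  "generated_invariant_sigma_algebra G act Z Q =
    \<Inter>{F. invariant_sigma_algebra G act Z F \<and> Q \<subseteq> F}"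

definition coincide_mod_null :: "'z measure \<Rightarrow> 'z set set \<Rightarrow> 'z set set \<Rightarrow> bool" where
  "coincide_mod_null N F F' \<longleftrightarrow>
    (\<forall>A\<in>F. \<exists>B\<in>F'. (A - B) \<union> (B - A) \<in> null_sets N) \<and>
    (\<forall>B\<in>F'. \<exists>A\<in>F. (A - B) \<union> (B - A) \<in> null_sets N)"

definition generating_partition ::
  "('g, 'm) monoid_scheme \<Rightarrow> ('g \<Rightarrow> 'z \<Rightarrow> 'z) \<Rightarrow> 'z measure \<Rightarrow> 'z set set \<Rightarrow> bool" where
  "generating_partition G act N Q \<longleftrightarrow>
    countable_measurable_partition N Q \<and>
    coincide_mod_null N (generated_invariant_sigma_algebra G act (space N) Q) (sets N)"

end

theory Submission
  imports Defs
begin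

text \<open>
  Let \<^term>\<open>P\<close> be a finite partition of the base space and \<^term>\<open>Q\<close> a generating partition of
  finite entropy. Since \<^term>\<open>Q\<close> generates, the \<^term>\<open>P\<close>-label of the coordinate at the identity
  is, up to a small error, a function of the \<^term>\<open>Q\<close>-labels of finitely many translates, and these
  can in turn be approximated by labels that depend on finitely many coordinates only. Such
  cylinder labels make sense on the finite model obtained by giving the points
  \<open>1, \<dots>, d\<close> of a sofic approximation independent values: at all but few points the
  local pattern is an exact copy of the pattern in the group, hence has the same law. The
  \<open>d\<close> independent \<^term>\<open>P\<close>-labels are therefore determined by \<open>d\<close> approximate
  \<^term>\<open>Q\<close>-labels and \<open>d\<close> correction variables, and subadditivity of Shannon entropy bounds
  \<open>d\<close> times the entropy of \<^term>\<open>P\<close> by \<open>d\<close> times the entropy of \<^term>\<open>Q\<close> plus a constant,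
  uniformly in \<^term>\<open>P\<close>.
\<close>

section \<open>Shannon entropy of finite-valued random variables\<close>

definition eta :: "real \<Rightarrow> real" where
  "eta t = - (t * ln t)"

lemma eta_0 [simp]: "eta 0 = 0" and eta_1 [simp]: "eta 1 = 0"
  by (auto simp: eta_def)

lemma eta_nonneg: "0 \<le> t \<Longrightarrow> t \<le> 1 \<Longrightarrow> 0 \<le> eta t"
  by (cases "t = 0") (auto simp: eta_def mult_nonneg_nonpos)

text \<open>From ln (1/t) \<le> 1/t - 1 one gets \<open>eta t\<close> \<le> 1 - t for positive t.
  The crude constant 1 bounds the contribution of any single value to an entropy.\<close>

lemma eta_le_1:
  assumes "0 \<le> t"
  shows "eta t \<le> 1"
proof (cases "t = 0")
  case False
  then have t: "0 < t" using assms by simp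
  then have "- ln t \<le> 1 / t - 1"
    using ln_le_minus_one[of "1 / t"] by (simp add: ln_div)
  then have "t * (- ln t) \<le> t * (1 / t - 1)"
    using t by (intro mult_left_mono) auto
  then show ?thesis using t by (simp add: eta_def algebra_simps)
qed simp

text \<open>Writing t = s * s gives \<open>eta t\<close> = 2 * s * \<open>eta s\<close>, and the
  last factor is at most 1. This makes the contribution of an improbable value small.\<close>

lemma eta_le_sqrt:
  assumes "0 \<le> t"
  shows "eta t \<le> 2 * sqrt t"
proof -
  define s where "s = sqrt t"
  have s: "0 \<le> s" "t = s * s" using assms by (auto simp: s_def)
  have "eta t = 2 * (s * eta s)"
    using s by (cases "s = 0") (auto simp: eta_def ln_mult algebra_simps)
  also have "\<dots> \<le> 2 * (s * 1)"
    using s eta_le_1[of s] by (intro mult_left_mono) auto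
  finally show ?thesis by (simp add: s_def)
qed

lemma eta_mult:
  assumes "0 \<le> x" "0 \<le> y"
  shows "eta (x * y) = x * eta y + y * eta x"
  using assms by (cases "x = 0 \<or> y = 0") (auto simp: eta_def ln_mult algebra_simps)

text \<open>Additivity of entropy for independent variables. By \<open>eta_mult\<close> a new
  coordinate splits each term into two mixed ones; summing out the other factor, which has total
  mass 1, decouples them.\<close>

lemma sum_eta_prod:
  fixes p :: "'a \<Rightarrow> real"
  assumes fin: "finite I" "finite S" and p: "\<And>a. a \<in> S \<Longrightarrow> 0 \<le> p a" "sum p S = 1"
  shows "(\<Sum>w\<in>PiE I (\<lambda>_. S). eta (\<Prod>i\<in>I. p (w i))) = real (card I) * (\<Sum>a\<in>S. eta (p a))"
  using fin(1)
proof (induction I rule: finite_induct)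
  case (insert i I)
  let ?T = "PiE I (\<lambda>_. S)" and ?q = "\<lambda>w. \<Prod>j\<in>I. p (w j)"
  have one: "(\<Sum>w\<in>?T. ?q w) = 1"
    using prod_sum_PiE[of I "\<lambda>_. S" "\<lambda>_. p"] insert.hyps fin(2) p(2) by simp
  have q: "0 \<le> ?q w" if "w \<in> ?T" for w
    using that p(1) by (intro prod_nonneg) (auto simp: PiE_iff)
  have upd: "?q (w(i := a)) = ?q w" for w a
    using insert.hyps by (intro prod.cong) auto
  have inj: "inj_on (\<lambda>(y, g). g(i := y)) (S \<times> ?T)"
    using inj_combinator[OF insert.hyps(2), of "\<lambda>_. S"] .
  have "(\<Sum>w\<in>PiE (insert i I) (\<lambda>_. S). eta (\<Prod>j\<in>insert i I. p (w j))) =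
        (\<Sum>(a, w)\<in>S \<times> ?T. eta (p a * ?q w))"
    unfolding PiE_insert_eq using insert.hyps
    by (subst sum.reindex[OF inj]) (auto simp: upd fun_upd_same simp del: fun_upd_apply intro!: sum.cong)
  also have "\<dots> = (\<Sum>a\<in>S. \<Sum>w\<in>?T. p a * eta (?q w) + ?q w * eta (p a))"
    unfolding sum.cartesian_product[symmetric] using p(1) q by (intro sum.cong eta_mult) auto
  also have "\<dots> = (\<Sum>a\<in>S. p a * (\<Sum>w\<in>?T. eta (?q w)) + eta (p a))"
    by (simp add: sum.distrib one flip: sum_distrib_left sum_distrib_right)
  also have "\<dots> = (\<Sum>w\<in>?T. eta (?q w)) + (\<Sum>a\<in>S. eta (p a))"
    by (simp add: sum.distrib p(2) flip: sum_distrib_right)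
  finally show ?case
    using insert by (simp add: algebra_simps)
qed simp

section \<open>Entropy of finite-valued variables: subadditivity, perturbation, independence\<close>

definition shannon :: "'z measure \<Rightarrow> ('z \<Rightarrow> 'b) \<Rightarrow> real" where
  "shannon N X = (\<Sum>a\<in>X ` space N. eta (measure N (X -` {a} \<inter> space N)))"

lemma shannon_eq_sum:
  assumes "finite S" "X ` space N \<subseteq> S"
  shows "shannon N X = (\<Sum>a\<in>S. eta (measure N (X -` {a} \<inter> space N)))"
proof -
  have "X -` {a} \<inter> space N = {}" if "a \<notin> X ` space N" for a
    using that by auto
  then show ?thesis
    unfolding shannon_def by (intro sum.mono_neutral_left assms) auto
qed

lemma shannon_cong:
  assumes "\<And>x. x \<in> space N \<Longrightarrow> X x = Y x"
  shows "shannon N X = shannon N Y"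
proof -
  have "X ` space N = Y ` space N" and "X -` {a} \<inter> space N = Y -` {a} \<inter> space N" for a
    using assms by auto
  then show ?thesis by (simp add: shannon_def)
qed

context prob_space
begin

text \<open>With base \<open>exp 1\<close> the logarithms agree, so data processing, the chain rule
  and the effect of conditioning can be taken over from \<open>entropy\<close>.\<close>

lemma shannon_eq_entropy:
  assumes "simple_function M X"
  shows "shannon M X = entropy (exp 1) (count_space (X ` space M)) X"
proof -
  interpret information_space M "exp 1" by unfold_locales simp
  show ?thesis
    unfolding entropy_simple_distributed[OF simple_distributedI[OF assms measure_nonneg refl]]
    by (simp add: shannon_def eta_def log_def sum_negf)
qed

lemma shannon_compose_le:
  assumes "simple_function M X" "\<And>x. x \<in> space M \<Longrightarrow> Y x = f (X x)"
  shows "shannon M Y \<le> shannon M X"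
proof -
  interpret information_space M "exp 1" by unfold_locales simp
  have "shannon M Y = shannon M (f \<circ> X)"
    using assms by (intro shannon_cong) auto
  then show ?thesis
    using entropy_data_processing[OF assms(1), of f] assms(1)
    by (simp add: shannon_eq_entropy simple_function_compose)
qed

lemma shannon_Pair_le:
  assumes "simple_function M X" "simple_function M Y"
  shows "shannon M (\<lambda>x. (X x, Y x)) \<le> shannon M X + shannon M Y"
proof -
  interpret information_space M "exp 1" by unfold_locales simp
  show ?thesis
    using entropy_chain_rule[OF assms] conditional_entropy_less_eq_entropy[OF assms(2,1)]
    by (simp add: shannon_eq_entropy simple_function_Pair assms)
qed

lemma simple_function_family:
  assumes "finite K" "\<And>k. k \<in> K \<Longrightarrow> simple_function M (X k)"
  shows "simple_function M (\<lambda>x. \<lambda>k\<in>K. X k x)"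
  using assms
proof (induction K rule: finite_induct)
  case (insert k K)
  have "simple_function M (\<lambda>x. (\<lambda>k\<in>K. X k x)(k := X k x))"
    by (rule simple_function_compose2[where h = "\<lambda>a f. f(k := a)", OF insert.prems insert.IH])
       (use insert.prems in auto)
  moreover have "(\<lambda>x. (\<lambda>k\<in>K. X k x)(k := X k x)) = (\<lambda>x. \<lambda>k\<in>insert k K. X k x)"
    using insert.hyps by (auto simp: fun_eq_iff)
  ultimately show ?case by (simp del: restrict_apply)
qed (simp add: restrict_def)

lemma shannon_family_le:
  assumes "finite K" "\<And>k. k \<in> K \<Longrightarrow> simple_function M (X k)"
  shows "shannon M (\<lambda>x. \<lambda>k\<in>K. X k x) \<le> (\<Sum>k\<in>K. shannon M (X k))"
  using assms
proof (induction K rule: finite_induct)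
  case empty
  show ?case
    using not_empty by (simp add: shannon_def image_constant_conv prob_space)
next
  case (insert k K)
  have sf: "simple_function M (X k)" "simple_function M (\<lambda>x. \<lambda>k\<in>K. X k x)"
    using insert by (auto intro!: simple_function_family)
  have "shannon M (\<lambda>x. \<lambda>k\<in>insert k K. X k x) \<le> shannon M (\<lambda>x. (X k x, \<lambda>k\<in>K. X k x))"
    using insert.hyps sf
    by (intro shannon_compose_le[where f = "\<lambda>(a, f). f(k := a)"] simple_function_Pair)
       (auto simp: fun_eq_iff)
  also have "\<dots> \<le> shannon M (X k) + shannon M (\<lambda>x. \<lambda>k\<in>K. X k x)"
    using sf by (rule shannon_Pair_le)
  also have "\<dots> \<le> shannon M (X k) + (\<Sum>k\<in>K. shannon M (X k))"
    by (rule add_left_mono, rule insert.IH) (use insert.prems in auto)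
  finally show ?case using insert.hyps by (simp del: restrict_apply)
qed

text \<open>Each value contributes at most 1. This rough bound serves for the few points of a sofic
  model where the local pattern is wrong.\<close>

lemma shannon_le_card:
  assumes "finite S" "X ` space M \<subseteq> S"
  shows "shannon M X \<le> card S"
proof -
  have "shannon M X \<le> (\<Sum>a\<in>S. 1)"
    unfolding shannon_eq_sum[OF assms] by (intro sum_mono eta_le_1 measure_nonneg)
  then show ?thesis by simp
qed

text \<open>The value \<open>c\<close> contributes at most 1. Every other value has probability at
  most \<open>e\<close> and contributes at most 2 * sqrt e; the second hypothesis on
  \<open>e\<close> is the square of the inequality saying that these terms add up to at most
  1.\<close>

lemma shannon_nearly_constant_le:
  assumes X: "simple_function M X" and S: "finite S" "X ` space M \<subseteq> insert c S"
    and p: "prob {x \<in> space M. X x \<noteq> c} \<le> e" "4 * real (card S) ^ 2 * e \<le> 1"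
  shows "shannon M X \<le> 2"
proof -
  have "0 \<le> e" using p(1) measure_nonneg[of M] by (rule order_trans[rotated])
  have "eta (prob (X -` {a} \<inter> space M)) \<le> 2 * sqrt e" if "a \<noteq> c" for a
  proof -
    have "prob (X -` {a} \<inter> space M) \<le> prob {x \<in> space M. X x \<noteq> c}"
      using that X by (intro finite_measure_mono) (auto intro!: simple_functionD(2)[OF X, of "UNIV - {c}", THEN back_subst[of "\<lambda>S. S \<in> sets M"]])
    then have "sqrt (prob (X -` {a} \<inter> space M)) \<le> sqrt e"
      using p(1) by simp
    then show ?thesis
      using eta_le_sqrt[of "prob (X -` {a} \<inter> space M)", OF measure_nonneg] by linarith
  qed
  then have "(\<Sum>a\<in>S - {c}. eta (prob (X -` {a} \<inter> space M))) \<le> (\<Sum>a\<in>S - {c}. 2 * sqrt e)"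
    by (intro sum_mono) auto
  also have "\<dots> \<le> card S * (2 * sqrt e)"
    using S \<open>0 \<le> e\<close> by (auto intro!: mult_right_mono card_mono)
  also have "\<dots> = sqrt (4 * real (card S) ^ 2 * e)"
    by (simp add: real_sqrt_mult)
  also have "\<dots> \<le> 1" using p(2) by simp
  finally have "(\<Sum>a\<in>S - {c}. eta (prob (X -` {a} \<inter> space M))) \<le> 1" .
  moreover have "shannon M X = eta (prob (X -` {c} \<inter> space M)) +
      (\<Sum>a\<in>S - {c}. eta (prob (X -` {a} \<inter> space M)))"
    using S by (subst shannon_eq_sum[of "insert c S"]) (auto simp: sum.insert_remove)
  moreover have "eta (prob (X -` {c} \<inter> space M)) \<le> 1"
    by (intro eta_le_1 measure_nonneg)
  ultimately show ?thesis by simp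
qed

end

text \<open>\<open>X\<close> is a function of \<open>Y\<close> and of a correction variable that is
  \<open>None\<close> where the two agree and otherwise reveals \<open>X\<close>. The correction is
  nearly constant, so it costs at most 2.\<close>

lemma (in prob_space) shannon_perturb_le:
  assumes X: "simple_function M X" and Y: "simple_function M Y" and S: "finite S" "X ` space M \<subseteq> S"
    and p: "prob {x \<in> space M. X x \<noteq> Y x} \<le> e" "4 * real (card S) ^ 2 * e \<le> 1"
  shows "shannon M X \<le> shannon M Y + 2"
proof -
  define err where "err = (\<lambda>x. if X x = Y x then None else Some (X x))"
  have err: "simple_function M err"
    unfolding err_def
    by (rule simple_function_compose2[where h = "\<lambda>a b. if a = b then None else Some a", OF X Y])
  have "shannon M X \<le> shannon M (\<lambda>x. (Y x, err x))"
    by (rule shannon_compose_le[where f = "\<lambda>(y, e). case e of None \<Rightarrow> y | Some a \<Rightarrow> a"])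
       (rule simple_function_Pair[OF Y err], simp add: err_def)
  also have "\<dots> \<le> shannon M Y + shannon M err"
    by (rule shannon_Pair_le[OF Y err])
  also have "shannon M err \<le> 2"
  proof (rule shannon_nearly_constant_le[OF err])
    show "finite (Some ` S)" "err ` space M \<subseteq> insert None (Some ` S)"
      using S by (auto simp: err_def)
    have "{x \<in> space M. err x \<noteq> None} = {x \<in> space M. X x \<noteq> Y x}"
      by (auto simp: err_def)
    then show "prob {x \<in> space M. err x \<noteq> None} \<le> e" using p(1) by simp
    show "4 * real (card (Some ` S)) ^ 2 * e \<le> 1"
      using p(2) by (simp add: card_image)
  qed
  finally show ?thesis by simp
qed

text \<open>A point is labelled by the set of all indices whose sets contain it. Such a label also
  makes sense for overlapping sets, as arise when the pieces of a partition are approximated by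
  cylinders.\<close>

lemma (in prob_space) simple_function_membership:
  assumes "finite R" "\<And>i. i \<in> R \<Longrightarrow> c i \<in> sets M"
  shows "simple_function M (\<lambda>y. {i \<in> R. y \<in> c i})"
  unfolding simple_function_def
proof (intro conjI ballI)
  show "finite ((\<lambda>y. {i \<in> R. y \<in> c i}) ` space M)"
    by (rule finite_subset[of _ "Pow R"]) (use assms(1) in auto)
  fix a assume "a \<in> (\<lambda>y. {i \<in> R. y \<in> c i}) ` space M"
  then have "a \<subseteq> R" by auto
  then have "(\<lambda>y. {i \<in> R. y \<in> c i}) -` {a} \<inter> space M = {y \<in> space M. \<forall>i\<in>R. y \<in> c i \<longleftrightarrow> i \<in> a}"
    by auto
  also have "\<dots> \<in> sets M"
  proof (rule sets.sets_Collect_finite_All[OF _ assms(1)])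
    fix i assume i: "i \<in> R"
    have "{y \<in> space M. y \<in> c i \<longleftrightarrow> i \<in> a} = (if i \<in> a then c i else space M - c i)"
      using sets.sets_into_space[OF assms(2)[OF i]] by auto
    then show "{y \<in> space M. y \<in> c i \<longleftrightarrow> i \<in> a} \<in> sets M"
      using assms(2)[OF i] by auto
  qed
  finally show "(\<lambda>y. {i \<in> R. y \<in> c i}) -` {a} \<inter> space M \<in> sets M" .
qed

text \<open>For disjoint sets the label is a singleton or empty. The empty label occurs off the
  union of \<open>R\<close> and accounts for the extra 1; it disappears when \<open>R\<close> covers
  the space.\<close>

lemma (in prob_space) shannon_disjoint_membership_le:
  assumes "finite R" "disjoint R" "\<Union>R \<subseteq> space M"
  shows "shannon M (\<lambda>y. {A \<in> R. y \<in> A}) \<le> (\<Sum>A\<in>R. eta (prob A)) + 1"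
    and "\<Union>R = space M \<Longrightarrow> {} \<notin> R \<Longrightarrow> shannon M (\<lambda>y. {A \<in> R. y \<in> A}) = (\<Sum>A\<in>R. eta (prob A))"
proof -
  let ?X = "\<lambda>y. {A \<in> R. y \<in> A}" and ?S = "(\<lambda>A. {A}) ` R"
  have X: "?X y = {A}" if "y \<in> A" "A \<in> R" for y A
    using that assms(2) by (auto simp: disjoint_def)
  have pre: "?X -` {{A}} \<inter> space M = A" if "A \<in> R" for A
  proof (intro equalityI subsetI)
    fix y assume "y \<in> A" then show "y \<in> ?X -` {{A}} \<inter> space M"
      using that assms(3) X[of y A] by auto
  qed auto
  have sumS: "(\<Sum>a\<in>?S. eta (prob (?X -` {a} \<inter> space M))) = (\<Sum>A\<in>R. eta (prob A))"
    by (subst sum.reindex) (auto simp: pre inj_on_def)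
  have img: "?X ` space M \<subseteq> insert {} ?S"
  proof (rule image_subsetI)
    fix y
    show "?X y \<in> insert {} ?S"
    proof (cases "?X y = {}")
      case False
      then obtain A where A: "A \<in> R" "y \<in> A" by auto
      then show ?thesis unfolding X[OF A(2,1)] by simp
    qed simp
  qed
  have "shannon M ?X = (\<Sum>a\<in>insert {} ?S. eta (prob (?X -` {a} \<inter> space M)))"
    by (rule shannon_eq_sum[OF _ img]) (use assms(1) in simp)
  also have "\<dots> = eta (prob (?X -` {{}} \<inter> space M)) + (\<Sum>A\<in>R. eta (prob A))"
    using assms(1) by (subst sum.insert) (auto simp: sumS[simplified])
  also have "\<dots> \<le> (\<Sum>A\<in>R. eta (prob A)) + 1"
    using eta_le_1[OF measure_nonneg, of M] by simp
  finally show "shannon M ?X \<le> (\<Sum>A\<in>R. eta (prob A)) + 1" .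
  show "shannon M ?X = (\<Sum>A\<in>R. eta (prob A))" if cover: "\<Union>R = space M" "{} \<notin> R"
  proof -
    have "?X ` space M \<subseteq> ?S"
    proof safe
      fix y assume "y \<in> space M"
      then obtain A where "A \<in> R" "y \<in> A" using cover by auto
      then show "?X y \<in> ?S" using X by auto
    qed
    then show ?thesis
      using shannon_eq_sum[of ?S ?X M] assms(1) sumS by simp
  qed
qed

text \<open>The fibres of the family of labels are boxes, whose measures are products of the
  one-coordinate probabilities, so \<open>sum_eta_prod\<close> applies.\<close>

lemma (in prob_space) shannon_iid:
  assumes "finite J" and X: "simple_function M X"
  shows "shannon (PiM J (\<lambda>_. M)) (\<lambda>x. \<lambda>k\<in>J. X (x k)) = card J * shannon M X"
proof -
  let ?N = "PiM J (\<lambda>_. M)" and ?S = "X ` space M"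
  let ?p = "\<lambda>a. prob (X -` {a} \<inter> space M)"
  interpret P: finite_product_prob_space "\<lambda>_. M" J
    by unfold_locales (rule assms(1))
  have S: "finite ?S" using simple_functionD(1)[OF X] .
  have "(\<Sum>a\<in>?S. ?p a) = prob (\<Union>a\<in>?S. X -` {a} \<inter> space M)"
    using S simple_functionD(2)[OF X]
    by (intro finite_measure_finite_Union[symmetric]) (auto simp: disjoint_family_on_def)
  also have "(\<Union>a\<in>?S. X -` {a} \<inter> space M) = space M" by auto
  finally have one: "(\<Sum>a\<in>?S. ?p a) = 1" by (simp add: prob_space)
  have "shannon ?N (\<lambda>x. \<lambda>k\<in>J. X (x k)) =
      (\<Sum>w\<in>PiE J (\<lambda>_. ?S). eta (measure ?N ((\<lambda>x. \<lambda>k\<in>J. X (x k)) -` {w} \<inter> space ?N)))"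
    by (intro shannon_eq_sum finite_PiE assms(1) S) (auto simp: space_PiM PiE_iff)
  also have "\<dots> = (\<Sum>w\<in>PiE J (\<lambda>_. ?S). eta (\<Prod>k\<in>J. ?p (w k)))"
  proof (intro sum.cong refl arg_cong[where f = eta])
    fix w assume w: "w \<in> PiE J (\<lambda>_. ?S)"
    have "(\<lambda>x. \<lambda>k\<in>J. X (x k)) -` {w} \<inter> space ?N = PiE J (\<lambda>k. X -` {w k} \<inter> space M)"
    proof (rule Set.set_eqI)
      fix x
      have "(\<lambda>k\<in>J. X (x k)) = w \<longleftrightarrow> (\<forall>k\<in>J. X (x k) = w k)"
        using w by (auto simp: fun_eq_iff PiE_iff extensional_def)
      then show "x \<in> (\<lambda>x. \<lambda>k\<in>J. X (x k)) -` {w} \<inter> space ?N \<longleftrightarrow> x \<in> PiE J (\<lambda>k. X -` {w k} \<inter> space M)"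
        by (auto simp: space_PiM PiE_iff)
    qed
    then show "measure ?N ((\<lambda>x. \<lambda>k\<in>J. X (x k)) -` {w} \<inter> space ?N) = (\<Prod>k\<in>J. ?p (w k))"
      using simple_functionD(2)[OF X] by (simp add: P.finite_measure_PiM_emb)
  qed
  also have "\<dots> = card J * (\<Sum>a\<in>?S. eta (?p a))"
    by (intro sum_eta_prod assms(1) S one measure_nonneg)
  finally show ?thesis by (simp add: shannon_def)
qed

section \<open>Approximation by finitely determined sets\<close>

text \<open>The measurable sets in the closure of the given family for the pseudometric that
  measures symmetric differences.\<close>

definition approximable :: "'z measure \<Rightarrow> 'z set set \<Rightarrow> 'z set set" where
  "approximable N \<A> = {B \<in> sets N. \<forall>e>0. \<exists>C\<in>\<A>. measure N (sym_diff B C) < e}"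

text \<open>The observables \<open>\<phi>\<close> are left abstract because two kinds occur: the
  coordinates of a point, and the membership of its translates in pieces of a partition.\<close>

definition determines :: "'z measure \<Rightarrow> ('i \<Rightarrow> 'z \<Rightarrow> 'v) \<Rightarrow> 'i set \<Rightarrow> 'z set \<Rightarrow> bool" where
  "determines N \<phi> F B \<longleftrightarrow>
    (\<forall>y\<in>space N. \<forall>z\<in>space N. (\<forall>i\<in>F. \<phi> i y = \<phi> i z) \<longrightarrow> (y \<in> B \<longleftrightarrow> z \<in> B))"

lemma determinesI:
  assumes "\<And>y z. y \<in> space N \<Longrightarrow> z \<in> space N \<Longrightarrow> (\<And>i. i \<in> F \<Longrightarrow> \<phi> i y = \<phi> i z) \<Longrightarrow> y \<in> B \<Longrightarrow> z \<in> B"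
  shows "determines N \<phi> F B"
  unfolding determines_def
proof (intro ballI impI iffI)
  fix y z assume yz: "y \<in> space N" "z \<in> space N" "\<forall>i\<in>F. \<phi> i y = \<phi> i z"
  show "z \<in> B" if "y \<in> B" using assms[OF yz(1,2)] yz(3) that by blast
  show "y \<in> B" if "z \<in> B" using assms[OF yz(2,1)] yz(3) that by simp
qed

lemma determinesD:
  assumes "determines N \<phi> F B" "y \<in> space N" "z \<in> space N" "\<And>i. i \<in> F \<Longrightarrow> \<phi> i y = \<phi> i z"
  shows "y \<in> B \<longleftrightarrow> z \<in> B"
  using assms unfolding determines_def by blast

definition finitary :: "'z measure \<Rightarrow> 'i set \<Rightarrow> ('i \<Rightarrow> 'z \<Rightarrow> 'v) \<Rightarrow> 'z set set" where
  "finitary N I \<phi> = {B \<in> sets N. \<exists>F. finite F \<and> F \<subseteq> I \<and> determines N \<phi> F B}"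

lemma finitary_iff:
  "B \<in> finitary N I \<phi> \<longleftrightarrow> B \<in> sets N \<and> (\<exists>F. finite F \<and> F \<subseteq> I \<and> determines N \<phi> F B)"
  unfolding finitary_def by blast

lemma finitaryI:
  assumes "B \<in> sets N" "finite F" "F \<subseteq> I" "determines N \<phi> F B"
  shows "B \<in> finitary N I \<phi>"
  using assms unfolding finitary_iff by blast

lemma algebra_finitary: "algebra (space N) (finitary N I \<phi>)"
proof -
  have "finitary N I \<phi> \<subseteq> Pow (space N)"
    by (auto simp: finitary_def dest: sets.sets_into_space)
  moreover have "{} \<in> finitary N I \<phi>"
    by (rule finitaryI[of _ _ "{}"]) (auto simp: determines_def)
  moreover have "space N - B \<in> finitary N I \<phi>" if B: "B \<in> finitary N I \<phi>" for B
  proof -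
    obtain F where F: "B \<in> sets N" "finite F" "F \<subseteq> I" "determines N \<phi> F B"
      using B unfolding finitary_iff by blast
    have "determines N \<phi> F (space N - B)"
      using determinesD[OF F(4)] by (intro determinesI) blast
    with F show ?thesis by (intro finitaryI) auto
  qed
  moreover have "B \<union> C \<in> finitary N I \<phi>" if BC: "B \<in> finitary N I \<phi>" "C \<in> finitary N I \<phi>" for B C
  proof -
    obtain F where F: "B \<in> sets N" "finite F" "F \<subseteq> I" "determines N \<phi> F B"
      using BC(1) unfolding finitary_iff by blast
    obtain F' where F': "C \<in> sets N" "finite F'" "F' \<subseteq> I" "determines N \<phi> F' C"
      using BC(2) unfolding finitary_iff by blast
    have "determines N \<phi> (F \<union> F') (B \<union> C)"
    proof (rule determinesI)
      fix y z assume "y \<in> space N" "z \<in> space N" "\<And>i. i \<in> F \<union> F' \<Longrightarrow> \<phi> i y = \<phi> i z" "y \<in> B \<union> C"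
      then show "z \<in> B \<union> C"
        using determinesD[OF F(4), of y z] determinesD[OF F'(4), of y z] by (metis UnCI UnE)
    qed
    with F F' show ?thesis by (intro finitaryI[of _ _ "F \<union> F'"]) auto
  qed
  ultimately show ?thesis
    unfolding algebra_iff_Un by (intro conjI ballI)
qed

text \<open>Complements preserve symmetric differences. A countable union is first replaced by a
  finite one, at cost e/2 by continuity of the measure, and then its finitely many members are
  approximated separately.\<close>

lemma (in finite_measure) sigma_algebra_approximable:
  assumes \<A>: "algebra (space M) \<A>" "\<A> \<subseteq> sets M"
  shows "sigma_algebra (space M) (approximable M \<A>)"
proof -
  interpret \<A>: algebra "space M" \<A> by fact
  have "approximable M \<A> \<subseteq> Pow (space M)"
    by (auto simp: approximable_def dest: sets.sets_into_space)
  moreover have "{} \<in> approximable M \<A>"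
    by (auto simp: approximable_def intro!: bexI[of _ "{}"])
  moreover have "space M - B \<in> approximable M \<A>" if B: "B \<in> approximable M \<A>" for B
  proof -
    have "\<exists>C\<in>\<A>. measure M (sym_diff (space M - B) C) < e" if e: "0 < e" for e
    proof -
      obtain C where C: "C \<in> \<A>" "measure M (sym_diff B C) < e"
        using B e by (auto simp: approximable_def)
      have "B \<subseteq> space M" "C \<subseteq> space M"
        using B C(1) \<A>(2) by (auto simp: approximable_def dest: sets.sets_into_space)
      then have "sym_diff (space M - B) (space M - C) = sym_diff B C" by auto
      then show ?thesis using C by (intro bexI[of _ "space M - C"]) auto
    qed
    then show ?thesis using B by (auto simp: approximable_def)
  qed
  moreover have "(\<Union>i. B i) \<in> approximable M \<A>" if "range B \<subseteq> approximable M \<A>" for B :: "nat \<Rightarrow> _"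
  proof -
    have B: "B i \<in> sets M" for i using that by (auto simp: approximable_def)
    have "\<exists>C\<in>\<A>. measure M (sym_diff (\<Union>i. B i) C) < e" if e: "0 < e" for e
    proof -
      define U where "U n = (\<Union>i<n. B i)" for n
      have U: "U n \<in> sets M" for n using B by (auto simp: U_def)
      have "incseq U" by (force simp: U_def incseq_def)
      then have "(\<lambda>n. measure M (U n)) \<longlonglongrightarrow> measure M (\<Union>n. U n)"
        using U by (intro finite_Lim_measure_incseq) auto
      moreover have UB: "(\<Union>n. U n) = (\<Union>i. B i)" by (auto simp: U_def)
      ultimately have "(\<lambda>n. measure M (U n)) \<longlonglongrightarrow> measure M (\<Union>i. B i)" by simp
      from LIMSEQ_D[OF this, of "e / 2"] e obtain n where n: "\<bar>measure M (U n) - measure M (\<Union>i. B i)\<bar> < e / 2"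
        by auto
      \<comment> \<open>Dividing by \<open>Suc n\<close> makes the \<open>n\<close> errors add up to
        at most e/2 and remains meaningful for n = 0.\<close>
      have "\<exists>C\<in>\<A>. measure M (sym_diff (B i) C) < e / (2 * real (Suc n))" for i
      proof -
        have "B i \<in> approximable M \<A>" using \<open>range B \<subseteq> approximable M \<A>\<close> by auto
        then show ?thesis using e by (simp add: approximable_def)
      qed
      then obtain C where C: "\<And>i. C i \<in> \<A>" "\<And>i. measure M (sym_diff (B i) (C i)) < e / (2 * real (Suc n))"
        by metis
      define D where "D = (\<Union>i<n. C i)"
      have D: "D \<in> \<A>" using C by (auto simp: D_def)
      have CM: "C i \<in> sets M" for i using C \<A>(2) by auto
      have "measure M (sym_diff (\<Union>i. B i) D) \<le>
            measure M (((\<Union>i. B i) - U n) \<union> (\<Union>i<n. sym_diff (B i) (C i)))"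
        using B CM U by (intro finite_measure_mono) (auto simp: U_def D_def)
      also have "\<dots> \<le> measure M ((\<Union>i. B i) - U n) + measure M (\<Union>i<n. sym_diff (B i) (C i))"
        using B CM U by (intro measure_Un_le) auto
      also have "measure M ((\<Union>i. B i) - U n) = measure M (\<Union>i. B i) - measure M (U n)"
        using B U UB by (intro finite_measure_Diff) auto
      also have "measure M (\<Union>i<n. sym_diff (B i) (C i)) \<le> (\<Sum>i<n. measure M (sym_diff (B i) (C i)))"
        using B CM by (intro measure_UNION_le) auto
      also have "\<dots> \<le> (\<Sum>i<n. e / (2 * real (Suc n)))"
        using C(2) by (intro sum_mono less_imp_le)
      also have "\<dots> \<le> e / 2"
        using e by (simp add: field_simps)
      finally show ?thesis using n D by (intro bexI[of _ D]) (auto simp: abs_if split: if_splits)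
    qed
    then show ?thesis using B by (auto simp: approximable_def)
  qed
  ultimately show ?thesis
    unfolding sigma_algebra_iff2 by blast
qed

lemma subset_approximable:
  assumes "\<A> \<subseteq> sets N"
  shows "\<A> \<subseteq> approximable N \<A>"
  using assms by (force simp: approximable_def)

lemma finitary_subset_sets: "finitary N I \<phi> \<subseteq> sets N"
  by (auto simp: finitary_def)

text \<open>One-coordinate cylinders generate the product sigma-algebra and are finitary, and the
  approximable sets form a sigma-algebra.\<close>

lemma sets_PiM_approximable:
  assumes "prob_space M"
  shows "sets (PiM I (\<lambda>_. M)) \<subseteq> approximable (PiM I (\<lambda>_. M)) (finitary (PiM I (\<lambda>_. M)) I (\<lambda>i y. y i))"
proof -
  let ?N = "PiM I (\<lambda>_. M)"
  interpret M: prob_space M by fact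
  interpret N: prob_space ?N by (intro prob_space_PiM assms)
  interpret S: sigma_algebra "space ?N" "approximable ?N (finitary ?N I (\<lambda>i y. y i))"
    by (intro N.sigma_algebra_approximable algebra_finitary finitary_subset_sets)
  have "sets ?N = sigma_sets (space ?N) {{f \<in> space ?N. f i \<in> A} | i A. i \<in> I \<and> A \<in> sets M}"
    by (simp add: sets_PiM_single space_PiM)
  also have "\<dots> \<subseteq> approximable ?N (finitary ?N I (\<lambda>i y. y i))"
  proof (rule S.sigma_sets_subset, rule order_trans[OF _ subset_approximable[OF finitary_subset_sets]], safe)
    fix i A assume iA: "i \<in> I" "A \<in> sets M"
    show "{f \<in> space ?N. f i \<in> A} \<in> finitary ?N I (\<lambda>i y. y i)"
      by (rule finitaryI[of _ _ "{i}"]) (use iA in \<open>auto simp: determines_def\<close>)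
  qed
  finally show ?thesis .
qed

text \<open>Since \<open>Z\<close> looks only at the coordinates in \<open>K\<close>, injectivity of
  \<open>\<tau>\<close> on \<open>K\<close> suffices: the values read there are independent with law
  \<open>M\<close> on either side. In a sofic model injectivity holds only on such finite
  windows.\<close>

lemma measure_PiM_reindex_finitary:
  assumes M: "prob_space M" and K: "finite K" "K \<subseteq> I" and Z: "Z \<in> sets (PiM I (\<lambda>_. M))"
    and det: "determines (PiM I (\<lambda>_. M)) (\<lambda>i y. y i) K Z"
    and \<tau>: "\<And>i. i \<in> I \<Longrightarrow> \<tau> i \<in> J" "inj_on \<tau> K"
  shows "measure (PiM J (\<lambda>_. M)) {x \<in> space (PiM J (\<lambda>_. M)). (\<lambda>i\<in>I. x (\<tau> i)) \<in> Z} =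
    measure (PiM I (\<lambda>_. M)) Z"
proof -
  interpret M: prob_space M by fact
  obtain x0 where x0: "x0 \<in> space M" using M.not_empty by auto
  \<comment> \<open>Filling the coordinates outside \<open>K\<close> with one fixed point turns
    \<open>Z\<close> into a condition on \<open>K\<close>-tuples.\<close>
  define ext where "ext w = (\<lambda>i\<in>I. if i \<in> K then w i else x0)" for w :: "'b \<Rightarrow> 'a"
  have "ext \<in> measurable (PiM K (\<lambda>_. M)) (PiM I (\<lambda>_. M))"
    unfolding ext_def
  proof (rule measurable_restrict)
    fix i assume "i \<in> I"
    show "(\<lambda>w. if i \<in> K then w i else x0) \<in> measurable (PiM K (\<lambda>_. M)) M"
      using x0 by (cases "i \<in> K") auto
  qed
  then have W: "ext -` Z \<inter> space (PiM K (\<lambda>_. M)) \<in> sets (PiM K (\<lambda>_. M))" (is "?W \<in> _")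
    using Z by (rule measurable_sets)
  \<comment> \<open>Both sides of the claim are instances of this equation, one for the identity of
    \<open>I\<close> and one for \<open>\<tau>\<close>.\<close>
  have reindex: "measure (PiM L (\<lambda>_. M)) {x \<in> space (PiM L (\<lambda>_. M)). (\<lambda>i\<in>I. x (f i)) \<in> Z} =
      measure (PiM K (\<lambda>_. M)) ?W"
    if f: "\<And>i. i \<in> I \<Longrightarrow> f i \<in> L" "inj_on f K" for L and f :: "'b \<Rightarrow> 'd"
  proof -
    let ?r = "\<lambda>x. \<lambda>i\<in>K. x (f i)"
    have r: "?r \<in> measurable (PiM L (\<lambda>_. M)) (PiM K (\<lambda>_. M))"
      using f K by (intro measurable_restrict measurable_component_singleton) auto
    have "(\<lambda>i\<in>I. x (f i)) \<in> Z \<longleftrightarrow> ext (?r x) \<in> Z" if "x \<in> space (PiM L (\<lambda>_. M))" for x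
    proof -
      have sp: "(\<lambda>i\<in>I. x (f i)) \<in> space (PiM I (\<lambda>_. M))" "ext (?r x) \<in> space (PiM I (\<lambda>_. M))"
        using that f x0 K by (auto simp: space_PiM PiE_iff ext_def)
      have eq: "(\<lambda>i\<in>I. x (f i)) i = ext (?r x) i" if "i \<in> K" for i
        using that K by (auto simp: ext_def)
      show ?thesis
        by (rule determinesD[OF det sp]) (rule eq)
    qed
    then have "{x \<in> space (PiM L (\<lambda>_. M)). (\<lambda>i\<in>I. x (f i)) \<in> Z} = ?r -` ?W \<inter> space (PiM L (\<lambda>_. M))"
      using measurable_space[OF r] by auto
    also have "measure (PiM L (\<lambda>_. M)) \<dots> = measure (distr (PiM L (\<lambda>_. M)) (PiM K (\<lambda>_. M)) ?r) ?W"
      using W r by (simp add: measure_distr)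
    also have "distr (PiM L (\<lambda>_. M)) (PiM K (\<lambda>_. M)) ?r = PiM K (\<lambda>_. M)"
      using distr_PiM_reindex[of L "\<lambda>_. M" f K] f K M by (auto simp: Pi_iff subset_eq)
    finally show ?thesis .
  qed
  have "Z = {x \<in> space (PiM I (\<lambda>_. M)). (\<lambda>i\<in>I. x i) \<in> Z}"
    using sets.sets_into_space[OF Z] by (auto simp: space_PiM extensional_restrict PiE_iff)
  then have "measure (PiM I (\<lambda>_. M)) Z = measure (PiM K (\<lambda>_. M)) ?W"
    using reindex[of "\<lambda>i. i" I] by simp
  then show ?thesis
    using reindex[of \<tau> J] \<tau> by simp
qed

text \<open>Every fibre of \<open>q\<close> is determined by \<open>K\<close>, so its probability is
  unchanged by the reindexing.\<close>

lemma shannon_PiM_reindex: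
  assumes M: "prob_space M" and K: "finite K" "K \<subseteq> I" and q: "simple_function (PiM I (\<lambda>_. M)) q"
    and det: "\<And>y z. y \<in> space (PiM I (\<lambda>_. M)) \<Longrightarrow> z \<in> space (PiM I (\<lambda>_. M)) \<Longrightarrow>
      (\<And>i. i \<in> K \<Longrightarrow> y i = z i) \<Longrightarrow> q y = q z"
    and \<tau>: "\<And>i. i \<in> I \<Longrightarrow> \<tau> i \<in> J" "inj_on \<tau> K"
  shows "shannon (PiM J (\<lambda>_. M)) (\<lambda>x. q (\<lambda>i\<in>I. x (\<tau> i))) = shannon (PiM I (\<lambda>_. M)) q"
proof -
  let ?I = "PiM I (\<lambda>_. M)" and ?J = "PiM J (\<lambda>_. M)" and ?\<phi> = "\<lambda>x. \<lambda>i\<in>I. x (\<tau> i)"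
  have \<phi>: "?\<phi> x \<in> space ?I" if "x \<in> space ?J" for x
    using that \<tau>(1) by (auto simp: space_PiM PiE_iff)
  have "shannon ?J (\<lambda>x. q (?\<phi> x)) =
      (\<Sum>a\<in>q ` space ?I. eta (measure ?J ((\<lambda>x. q (?\<phi> x)) -` {a} \<inter> space ?J)))"
    by (intro shannon_eq_sum simple_functionD(1)[OF q]) (use \<phi> in auto)
  also have "\<dots> = (\<Sum>a\<in>q ` space ?I. eta (measure ?I (q -` {a} \<inter> space ?I)))"
  proof (intro sum.cong refl arg_cong[where f = eta])
    fix a
    have "(\<lambda>x. q (?\<phi> x)) -` {a} \<inter> space ?J = {x \<in> space ?J. ?\<phi> x \<in> q -` {a} \<inter> space ?I}"
      using \<phi> by auto
    also have "measure ?J \<dots> = measure ?I (q -` {a} \<inter> space ?I)"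
    proof (rule measure_PiM_reindex_finitary[OF M K _ _ \<tau>])
      show "q -` {a} \<inter> space ?I \<in> sets ?I" by (rule simple_functionD(2)[OF q])
      show "determines ?I (\<lambda>i y. y i) K (q -` {a} \<inter> space ?I)"
      proof (rule determinesI)
        fix y z assume "y \<in> space ?I" "z \<in> space ?I" "\<And>i. i \<in> K \<Longrightarrow> y i = z i" "y \<in> q -` {a} \<inter> space ?I"
        then show "z \<in> q -` {a} \<inter> space ?I" using det[of y z] by auto
      qed
    qed
    finally show "measure ?J ((\<lambda>x. q (?\<phi> x)) -` {a} \<inter> space ?J) = measure ?I (q -` {a} \<inter> space ?I)" .
  qed
  finally show ?thesis by (simp add: shannon_def)
qed

section \<open>Bernoulli shifts and generating partitions\<close>

locale bernoulli_shift = group G + M: prob_space M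
  for G :: "('g, 'm) monoid_scheme" (structure) and M :: "'a measure"
begin

abbreviation N where "N \<equiv> bernoulli_space G M"
abbreviation act where "act \<equiv> bernoulli_action G"

sublocale N: prob_space N
  unfolding bernoulli_space_def by (intro prob_space_PiM M.prob_space_axioms)

lemma act_measurable [measurable]: "g \<in> carrier G \<Longrightarrow> act g \<in> measurable N N"
  unfolding bernoulli_space_def bernoulli_action_def
  by (intro measurable_restrict measurable_component_singleton) auto

lemma act_space: "g \<in> carrier G \<Longrightarrow> y \<in> space N \<Longrightarrow> act g y \<in> space N"
  by (rule measurable_space[OF act_measurable])

lemma distr_act: "g \<in> carrier G \<Longrightarrow> distr N N (act g) = N"
  unfolding bernoulli_space_def bernoulli_action_def
  by (rule distr_PiM_reindex) (auto intro!: M.prob_space_axioms inj_onI)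

lemma measure_act:
  assumes "g \<in> carrier G" "Z \<in> sets N"
  shows "measure N (act g -` Z \<inter> space N) = measure N Z"
  using measure_distr[OF act_measurable[OF assms(1)] assms(2)] distr_act[OF assms(1)] by simp

lemma act_act:
  assumes "g \<in> carrier G" "h \<in> carrier G"
  shows "act g (act h y) = act (g \<otimes> h) y"
  using assms by (auto simp: bernoulli_action_def fun_eq_iff inv_mult_group m_assoc)

lemma act_one: "y \<in> space N \<Longrightarrow> act \<one> y = y"
  by (auto simp: bernoulli_action_def bernoulli_space_def space_PiM PiE_iff extensional_def fun_eq_iff)

text \<open>Invariance of a sigma-algebra is phrased with images, while measurability and measure
  are controlled through preimages.\<close>

lemma act_image:
  assumes "g \<in> carrier G" "A \<subseteq> space N"
  shows "act g ` A = act (inv g) -` A \<inter> space N"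
proof (intro equalityI subsetI)
  fix z assume "z \<in> act g ` A"
  then obtain y where "y \<in> A" "z = act g y" by auto
  then show "z \<in> act (inv g) -` A \<inter> space N"
    using assms act_space by (auto simp: act_act act_one subset_eq)
next
  fix z assume "z \<in> act (inv g) -` A \<inter> space N"
  then have "act g (act (inv g) z) = z" "act (inv g) z \<in> A"
    using assms by (auto simp: act_act act_one)
  then show "z \<in> act g ` A" by (metis image_eqI)
qed

text \<open>Events decided by finitely many questions (g, A), each asking whether the translate of
  the point by \<open>g\<close> lies in the piece \<open>A\<close>.\<close>

abbreviation itineraries where
  "itineraries Q \<equiv> finitary N (carrier G \<times> Q) (\<lambda>i y. act (fst i) y \<in> snd i)"

text \<open>The sets approximable by itinerary events form an invariant sigma-algebra containing
  \<open>Q\<close>, and the generated one is the smallest of this kind.\<close>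

lemma generated_subset_approximable:
  assumes "Q \<subseteq> sets N"
  shows "generated_invariant_sigma_algebra G act (space N) Q \<subseteq> approximable N (itineraries Q)"
proof -
  have "sigma_algebra (space N) (approximable N (itineraries Q))"
    by (intro N.sigma_algebra_approximable algebra_finitary finitary_subset_sets)
  moreover have "act g ` B \<in> approximable N (itineraries Q)"
    if g: "g \<in> carrier G" and B: "B \<in> approximable N (itineraries Q)" for g B
  proof -
    have BN: "B \<in> sets N" using B by (simp add: approximable_def)
    let ?p = "\<lambda>C. act (inv g) -` C \<inter> space N"
    have pm: "?p C \<in> sets N" if "C \<in> sets N" for C
      using that g by (intro measurable_sets[OF act_measurable]) auto
    have "\<exists>C\<in>itineraries Q. measure N (sym_diff (?p B) C) < e" if "0 < e" for e
    proof -
      obtain C where C: "C \<in> itineraries Q" "measure N (sym_diff B C) < e"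
        using B \<open>0 < e\<close> by (auto simp: approximable_def)
      have CN: "C \<in> sets N" using C(1) finitary_subset_sets by blast
      obtain F where F: "finite F" "F \<subseteq> carrier G \<times> Q" "determines N (\<lambda>i y. act (fst i) y \<in> snd i) F C"
        using C(1) unfolding finitary_iff by blast
      \<comment> \<open>Asking about the translate by \<open>s\<close> of
        \<open>act (inv g) y\<close> is asking about the translate of \<open>y\<close> by
        \<open>s \<otimes> inv g\<close>, so each question is shifted on the right.\<close>
      let ?F = "(\<lambda>i. (fst i \<otimes> inv g, snd i)) ` F"
      have "determines N (\<lambda>i y. act (fst i) y \<in> snd i) ?F (?p C)"
      proof (rule determinesI)
        fix y z assume yz: "y \<in> space N" "z \<in> space N" "y \<in> ?p C"
          and eq: "\<And>i. i \<in> ?F \<Longrightarrow> (act (fst i) y \<in> snd i) = (act (fst i) z \<in> snd i)"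
        have "act (inv g) y \<in> C \<longleftrightarrow> act (inv g) z \<in> C"
        proof (rule determinesD[OF F(3)])
          fix i assume i: "i \<in> F"
          then have "fst i \<in> carrier G" using F(2) by auto
          then show "(act (fst i) (act (inv g) y) \<in> snd i) = (act (fst i) (act (inv g) z) \<in> snd i)"
            using eq[OF imageI[OF i]] g by (simp add: act_act)
        qed (use yz g act_space in auto)
        then show "z \<in> ?p C" using yz by auto
      qed
      then have "?p C \<in> itineraries Q"
        using F(1,2) g by (intro finitaryI[OF pm[OF CN], of ?F]) auto
      moreover have "sym_diff (?p B) (?p C) = ?p (sym_diff B C)" by auto
      then have "measure N (sym_diff (?p B) (?p C)) = measure N (sym_diff B C)"
        using measure_act[of "inv g" "sym_diff B C"] g BN CN by auto
      ultimately show ?thesis using C(2) by (metis (no_types, lifting))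
    qed
    then show ?thesis
      using pm[OF BN] act_image[OF g sets.sets_into_space[OF BN]] by (simp add: approximable_def)
  qed
  moreover have "Q \<subseteq> approximable N (itineraries Q)"
  proof (rule order_trans[OF _ subset_approximable[OF finitary_subset_sets]], rule subsetI)
    fix A assume A: "A \<in> Q"
    show "A \<in> itineraries Q"
    proof (rule finitaryI[of _ _ "{(\<one>, A)}"])
      show "determines N (\<lambda>i y. act (fst i) y \<in> snd i) {(\<one>, A)} A"
        by (auto simp: determines_def act_one)
    qed (use A assms in auto)
  qed
  ultimately show ?thesis
    unfolding generated_invariant_sigma_algebra_def invariant_sigma_algebra_def by blast
qed

lemma generating_partition_approximates:
  assumes "generating_partition G act N Q" "B \<in> sets N" "0 < e"
  shows "\<exists>D\<in>itineraries Q. measure N (sym_diff B D) < e"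
proof -
  have Q: "Q \<subseteq> sets N"
    using assms(1) by (auto simp: generating_partition_def countable_measurable_partition_def)
  obtain A where A: "A \<in> generated_invariant_sigma_algebra G act (space N) Q"
    "(A - B) \<union> (B - A) \<in> null_sets N"
    using assms(1,2) unfolding generating_partition_def coincide_mod_null_def by blast
  then have AN: "A \<in> approximable N (itineraries Q)"
    using generated_subset_approximable[OF Q] by blast
  then obtain D where D: "D \<in> itineraries Q" "measure N (sym_diff A D) < e"
    using assms(3) by (auto simp: approximable_def)
  have m: "A \<in> sets N" "D \<in> sets N"
    using AN D(1) finitary_subset_sets by (auto simp: approximable_def)
  have "measure N (sym_diff B D) \<le> measure N (((A - B) \<union> (B - A)) \<union> sym_diff A D)"
    using m assms(2) by (intro N.finite_measure_mono) auto
  also have "\<dots> \<le> measure N ((A - B) \<union> (B - A)) + measure N (sym_diff A D)"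
    using m assms(2) by (intro measure_Un_le) auto
  also have "measure N ((A - B) \<union> (B - A)) = 0"
    using A(2) by (simp add: null_sets_def measure_def)
  finally have "measure N (sym_diff B D) < e" using D(2) by linarith
  then show ?thesis using D(1) by (rule rev_bexI[rotated])
qed

end

section \<open>The entropy bound from a sofic model\<close>

text \<open>For each pair (s, t) the proportion of points violating either condition tends to 0, so
  a union bound over the finitely many pairs from \<open>T\<close> applies for some
  \<open>i\<close>.\<close>

lemma sofic_approximation_good_points:
  assumes \<sigma>: "sofic_approximation G d \<sigma>" and T: "finite T" "T \<subseteq> carrier G" and b: "0 < b"
  shows "\<exists>i. real (card {k \<in> {1..d i}. \<not> (\<forall>s\<in>T. \<forall>t\<in>T. \<sigma> i (s \<otimes>\<^bsub>G\<^esub> t) k = \<sigma> i s (\<sigma> i t k) \<and>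
    (s \<noteq> t \<longrightarrow> \<sigma> i s k \<noteq> \<sigma> i t k))}) \<le> b * real (d i)"
proof -
  have d: "0 < d i" for i using \<sigma> by (simp add: sofic_approximation_def)
  define P where "P i s t k \<longleftrightarrow> \<sigma> i (s \<otimes>\<^bsub>G\<^esub> t) k = \<sigma> i s (\<sigma> i t k)" for i s t k
  define R where "R i s t k \<longleftrightarrow> (s \<noteq> t \<longrightarrow> \<sigma> i s k \<noteq> \<sigma> i t k)" for i s t k
  let ?b = "\<lambda>X i s t. real (card {k \<in> {1..d i}. \<not> X i s t k}) / real (d i)"
  have compl: "?b X i s t = 1 - real (card {k \<in> {1..d i}. X i s t k}) / real (d i)"
    for X :: "nat \<Rightarrow> 'a \<Rightarrow> 'a \<Rightarrow> nat \<Rightarrow> bool" and i s t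
  proof -
    have "card {k \<in> {1..d i}. X i s t k} + card {k \<in> {1..d i}. \<not> X i s t k} =
        card ({k \<in> {1..d i}. X i s t k} \<union> {k \<in> {1..d i}. \<not> X i s t k})"
      by (intro card_Un_disjoint[symmetric]) auto
    also have "{k \<in> {1..d i}. X i s t k} \<union> {k \<in> {1..d i}. \<not> X i s t k} = {1..d i}" by auto
    finally have "real (card {k \<in> {1..d i}. X i s t k}) + real (card {k \<in> {1..d i}. \<not> X i s t k}) = real (d i)"
      by (simp flip: of_nat_add)
    then show ?thesis using d[of i] by (simp add: field_simps)
  qed
  have P: "(\<lambda>i. ?b P i s t) \<longlonglongrightarrow> 0" if "s \<in> T" "t \<in> T" for s t
  proof -
    have "(\<lambda>i. real (card {k \<in> {1..d i}. P i s t k}) / real (d i)) \<longlonglongrightarrow> 1"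
      using \<sigma> subsetD[OF T(2) that(1)] subsetD[OF T(2) that(2)]
      unfolding sofic_approximation_def P_def by blast
    then have "(\<lambda>i. 1 - real (card {k \<in> {1..d i}. P i s t k}) / real (d i)) \<longlonglongrightarrow> 1 - 1"
      by (intro tendsto_diff tendsto_const)
    then show ?thesis unfolding compl by simp
  qed
  have R: "(\<lambda>i. ?b R i s t) \<longlonglongrightarrow> 0" if "s \<in> T" "t \<in> T" for s t
  proof (cases "s = t")
    case False
    have "(\<lambda>i. real (card {k \<in> {1..d i}. \<sigma> i s k \<noteq> \<sigma> i t k}) / real (d i)) \<longlonglongrightarrow> 1"
      using \<sigma> subsetD[OF T(2) that(1)] subsetD[OF T(2) that(2)] False
      unfolding sofic_approximation_def by blast
    moreover have "R i s t k \<longleftrightarrow> \<sigma> i s k \<noteq> \<sigma> i t k" for i k using False by (simp add: R_def)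
    ultimately have "(\<lambda>i. 1 - real (card {k \<in> {1..d i}. R i s t k}) / real (d i)) \<longlonglongrightarrow> 1 - 1"
      by (intro tendsto_diff tendsto_const) simp
    then show ?thesis unfolding compl by simp
  qed (simp add: R_def)
  have "(\<lambda>i. \<Sum>s\<in>T. \<Sum>t\<in>T. ?b P i s t + ?b R i s t) \<longlonglongrightarrow> (\<Sum>s\<in>T. \<Sum>t\<in>T. 0 + 0)"
    by (intro tendsto_sum tendsto_add P R)
  then have "(\<lambda>i. \<Sum>s\<in>T. \<Sum>t\<in>T. ?b P i s t + ?b R i s t) \<longlonglongrightarrow> 0" by simp
  then have "\<forall>\<^sub>F i in sequentially. (\<Sum>s\<in>T. \<Sum>t\<in>T. ?b P i s t + ?b R i s t) < b"
    using b by (rule order_tendstoD)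
  then obtain i where i: "(\<Sum>s\<in>T. \<Sum>t\<in>T. ?b P i s t + ?b R i s t) < b"
    using eventually_happens sequentially_bot by blast
  let ?B = "\<lambda>s t. {k \<in> {1..d i}. \<not> P i s t k} \<union> {k \<in> {1..d i}. \<not> R i s t k}"
  have "card {k \<in> {1..d i}. \<not> (\<forall>s\<in>T. \<forall>t\<in>T. P i s t k \<and> R i s t k)} \<le> card (\<Union>s\<in>T. \<Union>t\<in>T. ?B s t)"
    using T(1) by (intro card_mono) auto
  also have "\<dots> \<le> (\<Sum>s\<in>T. card (\<Union>t\<in>T. ?B s t))"
    by (rule card_UN_le[OF T(1)])
  also have "\<dots> \<le> (\<Sum>s\<in>T. \<Sum>t\<in>T. card (?B s t))"
    by (intro sum_mono card_UN_le[OF T(1)])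
  also have "\<dots> \<le> (\<Sum>s\<in>T. \<Sum>t\<in>T. card {k \<in> {1..d i}. \<not> P i s t k} + card {k \<in> {1..d i}. \<not> R i s t k})"
    by (intro sum_mono card_Un_le)
  finally have "real (card {k \<in> {1..d i}. \<not> (\<forall>s\<in>T. \<forall>t\<in>T. P i s t k \<and> R i s t k)}) \<le>
      real (\<Sum>s\<in>T. \<Sum>t\<in>T. card {k \<in> {1..d i}. \<not> P i s t k} + card {k \<in> {1..d i}. \<not> R i s t k})"
    by (rule of_nat_mono)
  also have "\<dots> = (\<Sum>s\<in>T. \<Sum>t\<in>T. real (card {k \<in> {1..d i}. \<not> P i s t k}) + real (card {k \<in> {1..d i}. \<not> R i s t k}))"
    by (simp only: of_nat_sum of_nat_add)
  also have "\<dots> = (\<Sum>s\<in>T. \<Sum>t\<in>T. ?b P i s t + ?b R i s t) * real (d i)"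
    using d[of i] by (simp add: sum_distrib_right distrib_right)
  also have "\<dots> \<le> b * real (d i)"
    using i by (intro mult_right_mono) auto
  finally show ?thesis unfolding P_def R_def by blast
qed

section \<open>Comparison of entropies through the finite model\<close>

context bernoulli_shift
begin

text \<open>Here \<open>f\<close> guesses the label \<open>pl\<close> at the identity from the
  labels \<open>q\<close> of the translates by \<open>F\<close>. Per point of the model, the
  constant 3 consists of 2 for correcting wrong guesses at good points and 1 for the averaged cost
  of all bad points.\<close>

lemma shannon_le_sofic_model:
  assumes sofic: "sofic G" and pl: "simple_function M pl" and q: "simple_function N q"
    and E: "finite E" "E \<subseteq> carrier G"
      "\<And>y z. y \<in> space N \<Longrightarrow> z \<in> space N \<Longrightarrow> (\<And>h. h \<in> E \<Longrightarrow> y h = z h) \<Longrightarrow> q y = q z"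
    and F: "finite F" "F \<subseteq> carrier G"
    and small: "4 * real (card (pl ` space M)) ^ 2 *
      measure N {y \<in> space N. pl (y \<one>) \<noteq> f (\<lambda>s\<in>F. q (act s y))} \<le> 1"
  shows "shannon M pl \<le> shannon N q + 3"
proof -
  let ?Z = "{y \<in> space N. pl (y \<one>) \<noteq> f (\<lambda>s\<in>F. q (act s y))}"
  \<comment> \<open>The coordinates that decide whether the guess at the identity is wrong: the
    identity itself and the coordinates \<open>inv s \<otimes> h\<close> read by
    \<open>q (act s y)\<close>.\<close>
  define K where "K = insert \<one> (E \<union> (\<lambda>(s, h). inv s \<otimes> h) ` (F \<times> E))"
  have K: "finite K" "K \<subseteq> carrier G" "E \<subseteq> K" "\<one> \<in> K"
    using E(1,2) F by (auto simp: K_def subset_eq)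
  \<comment> \<open>Inverses of \<open>K\<close> serve to separate the coordinates read around a
    point, and together with \<open>F\<close> they give equivariance.\<close>
  define T where "T = (\<lambda>h. inv h) ` K \<union> F"
  have T: "finite T" "T \<subseteq> carrier G"
    using K F by (auto simp: T_def)
  \<comment> \<open>An upper bound for the entropy of a label together with its correction at any
    point: the number of values of \<open>q\<close> plus the number of possible corrections,
    including \<open>None\<close>.\<close>
  define C where "C = real (card (q ` space N)) + real (1 + card (pl ` space M))"
  have "0 < C" by (simp add: C_def)
  obtain d \<sigma> where \<sigma>: "sofic_approximation G d \<sigma>"
    using sofic by (auto simp: sofic_def)
  define good where "good i k \<longleftrightarrow> (\<forall>s\<in>T. \<forall>t\<in>T. \<sigma> i (s \<otimes> t) k = \<sigma> i s (\<sigma> i t k) \<and>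
    (s \<noteq> t \<longrightarrow> \<sigma> i s k \<noteq> \<sigma> i t k))" for i k
  obtain i where i: "real (card {k \<in> {1..d i}. \<not> good i k}) \<le> 1 / C * real (d i)"
    using sofic_approximation_good_points[OF \<sigma> T, of "1 / C"] \<open>0 < C\<close> unfolding good_def by auto
  define J where "J = {1..d i}"
  have J: "finite J" "card J = d i" "0 < d i"
    using \<sigma> by (auto simp: J_def sofic_approximation_def)
  have perm: "\<sigma> i s permutes J" if "s \<in> carrier G" for s
    using \<sigma> that by (auto simp: sofic_approximation_def sym_group_def J_def)
  have \<sigma>J: "\<sigma> i s k \<in> J" if "s \<in> carrier G" "k \<in> J" for s k
    using permutes_in_image[OF perm[OF that(1)]] that(2) by simp
  let ?X = "PiM J (\<lambda>_. M)"
  interpret X: prob_space ?X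
    by (intro prob_space_PiM M.prob_space_axioms)
  \<comment> \<open>The inverse makes \<open>k \<mapsto> \<phi> k x\<close> equivariant at good points.\<close>
  define \<phi> where "\<phi> k x = (\<lambda>h\<in>carrier G. x (\<sigma> i (inv h) k))" for k and x :: "nat \<Rightarrow> 'a"
  have \<phi>_meas: "\<phi> k \<in> measurable ?X N" if "k \<in> J" for k
    unfolding \<phi>_def bernoulli_space_def using that \<sigma>J
    by (intro measurable_restrict measurable_component_singleton) auto
  have \<phi>_space: "\<phi> k x \<in> space N" if "k \<in> J" "x \<in> space ?X" for k x
    using measurable_space[OF \<phi>_meas] that by blast
  have qk: "simple_function ?X (\<lambda>x. q (\<phi> k x))" if "k \<in> J" for k
    using \<phi>_meas[OF that] q by (rule simple_function_comp)
  have plk: "simple_function ?X (\<lambda>x. pl (x k))" if "k \<in> J" for k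
    using measurable_component_singleton[OF that] pl by (rule simple_function_comp)
  \<comment> \<open>The translate by \<open>s\<close> is replaced by the move from \<open>k\<close>
    to \<open>\<sigma> i s k\<close>, so that the guess uses only the labels \<open>q\<close> found
    at points of the model.\<close>
  define guess where "guess k x = f (\<lambda>s\<in>F. q (\<phi> (\<sigma> i s k) x))" for k x
  have guess: "simple_function ?X (guess k)" if "k \<in> J" for k
  proof -
    have "simple_function ?X (\<lambda>x. \<lambda>s\<in>F. q (\<phi> (\<sigma> i s k) x))"
      using F that \<sigma>J by (intro X.simple_function_family qk) auto
    then show ?thesis
      unfolding guess_def by (rule simple_function_compose1)
  qed
  define err where "err k x = (if pl (x k) = guess k x then None else Some (pl (x k)))" for k x
  have err: "simple_function ?X (err k)" if "k \<in> J" for k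
    unfolding err_def
    by (rule simple_function_compose2[where h = "\<lambda>a b. if a = b then None else Some a",
          OF plk[OF that] guess[OF that]])
  have err_img: "err k ` space ?X \<subseteq> insert None (Some ` pl ` space M)" if "k \<in> J" for k
    using that by (auto simp: err_def space_PiM PiE_iff)

  \<comment> \<open>At \<open>h\<close>, the left pattern reads \<open>x\<close> at
    \<open>\<sigma> i (inv h) (\<sigma> i s k)\<close> and the right one at
    \<open>\<sigma> i (inv h \<otimes> s) k\<close>. These points agree when \<open>k\<close> is
    good and \<open>h\<close> lies in the window \<open>E\<close> of \<open>q\<close>.\<close>
  have equiv: "q (\<phi> (\<sigma> i s k) x) = q (act s (\<phi> k x))"
    if k: "k \<in> J" "good i k" and s: "s \<in> F" and x: "x \<in> space ?X" for k s x
  proof (rule E(3))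
    show "\<phi> (\<sigma> i s k) x \<in> space N" "act s (\<phi> k x) \<in> space N"
      using k s x F \<sigma>J by (auto intro!: \<phi>_space act_space)
    fix h assume h: "h \<in> E"
    have c: "s \<in> carrier G" "h \<in> carrier G" using s h E(2) F by auto
    have "inv (inv s \<otimes> h) = inv h \<otimes> s"
      using c by (simp add: inv_mult_group)
    moreover have "inv h \<in> T" "s \<in> T"
      using h s K by (auto simp: T_def)
    then have "\<sigma> i (inv h \<otimes> s) k = \<sigma> i (inv h) (\<sigma> i s k)"
      using k(2) unfolding good_def by blast
    ultimately show "\<phi> (\<sigma> i s k) x h = act s (\<phi> k x) h"
      using c by (simp add: \<phi>_def bernoulli_action_def)
  qed
  \<comment> \<open>Multiplicativity for the pair of identities makes
    \<open>\<sigma> i \<one>\<close> idempotent at \<open>k\<close>; being a permutation, it then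
    fixes \<open>k\<close>.\<close>
  have origin: "\<phi> k x \<one> = x k" if k: "k \<in> J" "good i k" for k x
  proof -
    have "inv \<one> \<in> T" unfolding T_def using K(4) by (intro UnI1 imageI)
    then have "\<one> \<in> T" by simp
    then have "\<sigma> i (\<one> \<otimes> \<one>) k = \<sigma> i \<one> (\<sigma> i \<one> k)"
      using k(2) unfolding good_def by blast
    then have "\<sigma> i \<one> (\<sigma> i \<one> k) = \<sigma> i \<one> k" by simp
    then have "\<sigma> i \<one> k = k"
      using permutes_inj[OF perm[OF one_closed]] by (simp add: inj_eq)
    then show ?thesis by (simp add: \<phi>_def)
  qed
  have inj: "inj_on (\<lambda>h. \<sigma> i (inv h) k) K" if "good i k" for k
  proof (rule inj_onI, rule ccontr)
    fix g h assume gh: "g \<in> K" "h \<in> K" "\<sigma> i (inv g) k = \<sigma> i (inv h) k" "g \<noteq> h"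
    have "g \<in> carrier G" "h \<in> carrier G" using gh K(2) by blast+
    then have "inv g \<noteq> inv h" using gh(4) by (metis inv_inv)
    moreover have "inv g \<in> T" "inv h \<in> T"
      unfolding T_def using gh(1,2) by simp_all
    ultimately show False using that gh(3) unfolding good_def by blast
  qed
  have q_good: "shannon ?X (\<lambda>x. q (\<phi> k x)) = shannon N q" if k: "k \<in> J" "good i k" for k
    unfolding \<phi>_def bernoulli_space_def
  proof (rule shannon_PiM_reindex[OF M.prob_space_axioms E(1,2) q[unfolded bernoulli_space_def]])
    show "q y = q z" if "y \<in> space (PiM (carrier G) (\<lambda>_. M))" "z \<in> space (PiM (carrier G) (\<lambda>_. M))"
      "\<And>h. h \<in> E \<Longrightarrow> y h = z h" for y z
      using that by (rule E(3)[unfolded bernoulli_space_def])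
    show "\<sigma> i (inv h) k \<in> J" if "h \<in> carrier G" for h using \<sigma>J that k by auto
    show "inj_on (\<lambda>h. \<sigma> i (inv h) k) E" by (rule inj_on_subset[OF inj[OF k(2)] K(3)])
  qed
  have Z: "?Z \<in> sets N"
  proof -
    have pl1: "simple_function N (\<lambda>y. pl (y \<one>))"
      using pl by (intro simple_function_comp[of "\<lambda>y. y \<one>" N M]) (simp_all add: bernoulli_space_def)
    have "simple_function N (\<lambda>y. f (\<lambda>s\<in>F. q (act s y)))"
      using F by (intro simple_function_compose1[where g = f] N.simple_function_family
        simple_function_comp[OF act_measurable q]) auto
    from simple_function_Pair[OF pl1 this]
    have "(\<lambda>y. (pl (y \<one>), f (\<lambda>s\<in>F. q (act s y)))) -` {(a, b). a \<noteq> b} \<inter> space N \<in> sets N"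
      by (rule simple_functionD(2))
    also have "(\<lambda>y. (pl (y \<one>), f (\<lambda>s\<in>F. q (act s y)))) -` {(a, b). a \<noteq> b} \<inter> space N = ?Z"
      by auto
    finally show ?thesis .
  qed
  \<comment> \<open>By \<open>equiv\<close> and \<open>origin\<close>, a correction is needed at a
    good point exactly when the pattern \<open>\<phi> k x\<close> lies in \<open>?Z\<close>. This
    event depends on \<open>K\<close> only, so it keeps its probability from the Bernoulli
    space.\<close>
  have err_good: "shannon ?X (err k) \<le> 2" if k: "k \<in> J" "good i k" for k
  proof (rule X.shannon_nearly_constant_le[OF err[OF k(1)] _ err_img[OF k(1)]])
    show "finite (Some ` pl ` space M)" using simple_functionD(1)[OF pl] by simp
    show "4 * real (card (Some ` pl ` space M)) ^ 2 * measure N ?Z \<le> 1"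
      using small by (simp add: card_image)
    have "err k x \<noteq> None \<longleftrightarrow> \<phi> k x \<in> ?Z" if x: "x \<in> space ?X" for x
    proof -
      have "guess k x = f (\<lambda>s\<in>F. q (act s (\<phi> k x)))"
        unfolding guess_def using equiv[OF k _ x] by (intro arg_cong[where f = f]) auto
      then show ?thesis
        using \<phi>_space[OF k(1) x] origin[OF k] by (simp add: err_def)
    qed
    then have "{x \<in> space ?X. err k x \<noteq> None} = {x \<in> space ?X. (\<lambda>h\<in>carrier G. x (\<sigma> i (inv h) k)) \<in> ?Z}"
      unfolding \<phi>_def by blast
    also have "measure ?X \<dots> = measure (PiM (carrier G) (\<lambda>_. M)) ?Z"
    proof (rule measure_PiM_reindex_finitary[OF M.prob_space_axioms K(1,2)])
      show "?Z \<in> sets (PiM (carrier G) (\<lambda>_. M))"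
        using Z by (simp add: bernoulli_space_def)
      show "\<sigma> i (inv h) k \<in> J" if "h \<in> carrier G" for h using \<sigma>J that k by auto
      show "inj_on (\<lambda>h. \<sigma> i (inv h) k) K" by (rule inj[OF k(2)])
      show "determines (PiM (carrier G) (\<lambda>_. M)) (\<lambda>i y. y i) K ?Z"
      proof (rule determinesI)
        fix y z assume "y \<in> space (PiM (carrier G) (\<lambda>_. M))" "z \<in> space (PiM (carrier G) (\<lambda>_. M))"
          and eq: "\<And>h. h \<in> K \<Longrightarrow> y h = z h" and yZ: "y \<in> ?Z"
        then have yz: "y \<in> space N" "z \<in> space N" by (simp_all add: bernoulli_space_def)
        have "q (act s y) = q (act s z)" if s: "s \<in> F" for s
        proof (rule E(3))
          show "act s y \<in> space N" "act s z \<in> space N"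
            using yz s F by (auto intro: act_space)
          fix h assume h: "h \<in> E"
          then have "inv s \<otimes> h \<in> K" using s by (auto simp: K_def)
          then show "act s y h = act s z h"
            using eq h E(2) by (auto simp: bernoulli_action_def)
        qed
        then have "(\<lambda>s\<in>F. q (act s y)) = (\<lambda>s\<in>F. q (act s z))" by auto
        then show "z \<in> ?Z" using yZ yz eq[OF K(4)] by simp
      qed
    qed
    finally show "measure ?X {x \<in> space ?X. err k x \<noteq> None} \<le> measure N ?Z"
      unfolding bernoulli_space_def by (rule eq_refl)
  qed

  have "real (d i) * shannon M pl = shannon ?X (\<lambda>x. \<lambda>k\<in>J. pl (x k))"
    using M.shannon_iid[OF J(1) pl] J(2) by simp
  \<comment> \<open>Decoding: where the correction is \<open>None\<close>, the guess is recomputed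
    from the recorded labels at the points \<open>\<sigma> i s k\<close>; otherwise the correction
    contains the true label.\<close>
  also have "\<dots> \<le> shannon ?X (\<lambda>x. \<lambda>k\<in>J. (q (\<phi> k x), err k x))"
  proof (rule X.shannon_compose_le[where f = "\<lambda>w. \<lambda>k\<in>J.
        case snd (w k) of None \<Rightarrow> f (\<lambda>s\<in>F. fst (w (\<sigma> i s k))) | Some a \<Rightarrow> a"])
    show "simple_function ?X (\<lambda>x. \<lambda>k\<in>J. (q (\<phi> k x), err k x))"
      by (intro X.simple_function_family J(1) simple_function_Pair qk err)
    fix x assume "x \<in> space ?X"
    let ?w = "\<lambda>k\<in>J. (q (\<phi> k x), err k x)"
    have "guess k x = f (\<lambda>s\<in>F. fst (?w (\<sigma> i s k)))" if "k \<in> J" for k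
      unfolding guess_def using that \<sigma>J F by (intro arg_cong[where f = f]) (auto simp: fun_eq_iff)
    then show "(\<lambda>k\<in>J. pl (x k)) =
        (\<lambda>k\<in>J. case snd (?w k) of None \<Rightarrow> f (\<lambda>s\<in>F. fst (?w (\<sigma> i s k))) | Some a \<Rightarrow> a)"
      by (intro restrict_ext) (simp add: err_def)
  qed
  also have "\<dots> \<le> (\<Sum>k\<in>J. shannon ?X (\<lambda>x. (q (\<phi> k x), err k x)))"
    by (intro X.shannon_family_le J(1) simple_function_Pair qk err)
  also have "\<dots> \<le> (\<Sum>k\<in>J. shannon N q + 2 + (if good i k then 0 else C))"
  proof (rule sum_mono)
    fix k assume k: "k \<in> J"
    have pair: "shannon ?X (\<lambda>x. (q (\<phi> k x), err k x)) \<le> shannon ?X (\<lambda>x. q (\<phi> k x)) + shannon ?X (err k)"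
      by (rule X.shannon_Pair_le[OF qk[OF k] err[OF k]])
    show "shannon ?X (\<lambda>x. (q (\<phi> k x), err k x)) \<le> shannon N q + 2 + (if good i k then 0 else C)"
    proof (cases "good i k")
      case True
      then show ?thesis using pair q_good[OF k] err_good[OF k] by simp
    next
      case False
      have "shannon ?X (\<lambda>x. q (\<phi> k x)) \<le> card (q ` space N)"
        by (rule X.shannon_le_card) (use simple_functionD(1)[OF q] \<phi>_space[OF k] in auto)
      moreover have "shannon ?X (err k) \<le> card (insert None (Some ` pl ` space M))"
        by (rule X.shannon_le_card[OF _ err_img[OF k]]) (use simple_functionD(1)[OF pl] in auto)
      moreover have "card (insert None (Some ` pl ` space M)) = 1 + card (pl ` space M)"
        using simple_functionD(1)[OF pl] by (simp add: card_image image_iff)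
      moreover have "0 \<le> shannon N q"
        unfolding shannon_def by (intro sum_nonneg eta_nonneg) auto
      ultimately show ?thesis using pair False by (simp add: C_def)
    qed
  qed
  also have "\<dots> = real (d i) * (shannon N q + 2) + C * real (card {k \<in> J. \<not> good i k})"
  proof -
    have "(\<Sum>k\<in>J. if good i k then 0 else C) = (\<Sum>k\<in>{k \<in> J. \<not> good i k}. C)"
      using J(1) by (intro sum.mono_neutral_cong_right) auto
    then show ?thesis by (simp add: sum.distrib J(2))
  qed
  \<comment> \<open>Bad points make up at most the fraction 1/C of the model, so together they cost
    at most 1 per point.\<close>
  also have "C * real (card {k \<in> J. \<not> good i k}) \<le> real (d i)"
    using i \<open>0 < C\<close> by (simp add: J_def field_simps)
  finally have "real (d i) * shannon M pl \<le> real (d i) * (shannon N q + 3)"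
    by (simp add: algebra_simps)
  then show ?thesis using J(3) by simp
qed

end

text \<open>All terms of the entropy series are nonnegative, so the bound is uniform over the finite
  subfamilies of a countable partition.\<close>

lemma sum_eta_le_partition_entropy:
  assumes "prob_space N" "finite R" "R \<subseteq> Q" "partition_entropy N Q \<le> ennreal c" "0 \<le> c"
  shows "(\<Sum>A\<in>R. eta (measure N A)) \<le> c"
proof -
  interpret prob_space N by fact
  have "ennreal (\<Sum>A\<in>R. eta (prob A)) = (\<Sum>A\<in>R. ennreal (eta (prob A)))"
    by (intro sum_ennreal[symmetric] eta_nonneg) auto
  also have "\<dots> = (\<Sum>\<^sub>\<infinity>A\<in>R. ennreal (eta (prob A)))"
    using assms(2) by simp
  also have "\<dots> \<le> partition_entropy N Q"
    unfolding partition_entropy_def eta_def using assms(3)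
    by (intro infsum_mono_neutral nonneg_summable_on_complete) auto
  finally show ?thesis
    using assms(4,5) by (metis ennreal_le_iff order_trans)
qed

section \<open>Entropy of a generating partition as a bound for the base space\<close>

context bernoulli_shift
begin

text \<open>The constant 6 is 3 from the sofic model, 2 from passing between cylinder labels and
  true labels, and 1 for the points outside the finitely many pieces of \<open>Q\<close> in use. It
  does not depend on \<open>P\<close>, while all error tolerances may.\<close>

lemma shannon_le_partition_entropy:
  assumes sofic: "sofic G" and Q: "generating_partition G act N Q" "partition_entropy N Q \<le> ennreal c" "0 \<le> c"
    and P: "finite P" "P \<subseteq> sets M"
  shows "shannon M (\<lambda>x. {p \<in> P. x \<in> p}) \<le> c + 6"
proof -
  let ?pl = "\<lambda>x. {p \<in> P. x \<in> p}"
  have QN: "Q \<subseteq> sets N" "disjoint Q" "\<Union>Q = space N"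
    using Q(1) by (auto simp: generating_partition_def countable_measurable_partition_def partition_on_def)
  define m where "m = real (card (?pl ` space M))"
  have m: "0 < m"
  proof -
    have "finite (?pl ` space M)" by (rule finite_subset[of _ "Pow P"]) (use P(1) in auto)
    then show ?thesis using M.not_empty by (simp add: m_def card_gt_0_iff)
  qed
  \<comment> \<open>The sofic bound tolerates a wrong guess with probability 1/(4 m^2). Half of this
    is reserved for approximating the events \<open>?B p\<close> by itinerary events; adding 1 to
    the cardinality keeps the denominator positive.\<close>
  define e1 where "e1 = 1 / (8 * m\<^sup>2 * (real (card P) + 1))"
  have e1: "0 < e1" "4 * m\<^sup>2 * (real (card P) * e1) \<le> 1 / 2"
  proof -
    show "0 < e1" using m by (simp add: e1_def)
    then have "4 * m\<^sup>2 * (real (card P) * e1) \<le> 4 * m\<^sup>2 * ((real (card P) + 1) * e1)"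
      by (intro mult_left_mono mult_right_mono) auto
    also have "\<dots> = 1 / 2" using m by (simp add: e1_def)
    finally show "4 * m\<^sup>2 * (real (card P) * e1) \<le> 1 / 2" .
  qed
  let ?B = "\<lambda>p. {y \<in> space N. y \<one> \<in> p}"
  have B: "?B p \<in> sets N" if "p \<in> P" for p
  proof -
    have "(\<lambda>y. y \<one>) -` p \<inter> space N \<in> sets N"
      unfolding bernoulli_space_def using that P(2)
      by (intro measurable_sets[OF measurable_component_singleton]) auto
    also have "(\<lambda>y. y \<one>) -` p \<inter> space N = ?B p" by auto
    finally show ?thesis .
  qed
  have "\<exists>D. D \<in> itineraries Q \<and> measure N (sym_diff (?B p) D) < e1" if "p \<in> P" for p
    using generating_partition_approximates[OF Q(1) B[OF that] e1(1)] by blast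
  then have "\<forall>p\<in>P. \<exists>D. D \<in> itineraries Q \<and> measure N (sym_diff (?B p) D) < e1" by blast
  from bchoice[OF this] obtain D where D: "\<And>p. p \<in> P \<Longrightarrow> D p \<in> itineraries Q"
    "\<And>p. p \<in> P \<Longrightarrow> measure N (sym_diff (?B p) (D p)) < e1"
    by blast
  have "\<exists>W. finite W \<and> W \<subseteq> carrier G \<times> Q \<and> determines N (\<lambda>i y. act (fst i) y \<in> snd i) W (D p)" if "p \<in> P" for p
    using D(1)[OF that] unfolding finitary_iff by (rule conjunct2)
  then have "\<forall>p\<in>P. \<exists>W. finite W \<and> W \<subseteq> carrier G \<times> Q \<and> determines N (\<lambda>i y. act (fst i) y \<in> snd i) W (D p)"
    by (rule ballI)
  from bchoice[OF this] obtain W where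
    W: "\<forall>p\<in>P. finite (W p) \<and> W p \<subseteq> carrier G \<times> Q \<and> determines N (\<lambda>i y. act (fst i) y \<in> snd i) (W p) (D p)"
    by (rule exE)
  \<comment> \<open>Only finitely many translates and finitely many pieces of \<open>Q\<close> enter
    the itinerary events \<open>D p\<close>.\<close>
  define F where "F = fst ` (\<Union>p\<in>P. W p)"
  define R where "R = snd ` (\<Union>p\<in>P. W p)"
  have "finite (\<Union>p\<in>P. W p)" "(\<Union>p\<in>P. W p) \<subseteq> carrier G \<times> Q"
    using W P(1) by auto
  then have F: "finite F" "F \<subseteq> carrier G" and R: "finite R" "R \<subseteq> Q"
    unfolding F_def R_def by (simp_all add: image_subset_iff subset_eq mem_Times_iff)
  have FR: "s \<in> F \<and> A \<in> R" if "p \<in> P" "(s, A) \<in> W p" for p s A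
  proof -
    have "(s, A) \<in> (\<Union>p\<in>P. W p)" using that by blast
    then show ?thesis unfolding F_def R_def by (metis fst_conv image_eqI snd_conv)
  qed

  \<comment> \<open>\<open>L\<close> dominates two coefficients: m^2 times the number of translates,
    through which errors in \<open>q\<close> reach the guess, and the squared number of possible
    labels, from the perturbation of \<open>q'\<close> into \<open>q\<close>. The choice of
    \<open>e2\<close> keeps either product at most 1/8.\<close>
  define L where "L = m\<^sup>2 * (real (card F) + 1) + (real (card (Pow R)))\<^sup>2"
  define e2 where "e2 = 1 / (8 * L * (real (card R) + 1))"
  have L: "0 < L" "m\<^sup>2 * real (card F) \<le> L" "(real (card (Pow R)))\<^sup>2 \<le> L"
  proof -
    show "0 < L" unfolding L_def by (rule add_pos_nonneg) (use m in simp_all)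
    show "m\<^sup>2 * real (card F) \<le> L" unfolding L_def by (simp add: distrib_left)
    show "(real (card (Pow R)))\<^sup>2 \<le> L" unfolding L_def by simp
  qed
  have "0 < e2" using L by (simp add: e2_def)
  have e2: "x * (real (card R) * e2) \<le> 1 / 8" if "0 \<le> x" "x \<le> L" for x
  proof -
    have "x * (real (card R) * e2) \<le> L * ((real (card R) + 1) * e2)"
      using that \<open>0 < e2\<close> by (intro mult_mono mult_right_mono) auto
    also have "\<dots> = 1 / 8" using L(1) by (simp add: e2_def)
    finally show ?thesis .
  qed
  have RN: "A \<in> sets N" if "A \<in> R" for A using that R QN by auto
  have "\<exists>c. c \<in> finitary N (carrier G) (\<lambda>h y. y h) \<and> measure N (sym_diff A c) < e2" if "A \<in> R" for A
  proof -
    have "A \<in> approximable N (finitary N (carrier G) (\<lambda>h y. y h))"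
      using sets_PiM_approximable[OF M.prob_space_axioms, of "carrier G"] RN[OF that]
      unfolding bernoulli_space_def by (rule subsetD)
    then show ?thesis using \<open>0 < e2\<close> unfolding approximable_def by blast
  qed
  then obtain cyl where cyl: "\<And>A. A \<in> R \<Longrightarrow> cyl A \<in> finitary N (carrier G) (\<lambda>h y. y h)"
    "\<And>A. A \<in> R \<Longrightarrow> measure N (sym_diff A (cyl A)) < e2"
    by metis
  have cylN: "cyl A \<in> sets N" if "A \<in> R" for A
    using cyl(1)[OF that] finitary_subset_sets by blast
  have "\<exists>E. finite E \<and> E \<subseteq> carrier G \<and> determines N (\<lambda>h y. y h) E (cyl A)" if "A \<in> R" for A
    using cyl(1)[OF that] unfolding finitary_iff by (rule conjunct2)
  then have "\<forall>A\<in>R. \<exists>E. finite E \<and> E \<subseteq> carrier G \<and> determines N (\<lambda>h y. y h) E (cyl A)"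
    by (rule ballI)
  from bchoice[OF this] obtain E where
    E: "\<forall>A\<in>R. finite (E A) \<and> E A \<subseteq> carrier G \<and> determines N (\<lambda>h y. y h) (E A) (cyl A)"
    by (rule exE)

  \<comment> \<open>\<open>q'\<close> records the true pieces and \<open>q\<close> their cylinder
    approximations. Only \<open>q\<close> can be evaluated in the finite model, whereas the entropy
    of \<open>q'\<close> is controlled by that of \<open>Q\<close>.\<close>
  define q' where "q' y = {A \<in> R. y \<in> A}" for y
  define q where "q y = {A \<in> R. y \<in> cyl A}" for y
  have q': "simple_function N q'"
    unfolding q'_def by (rule N.simple_function_membership[OF R(1)]) (rule RN)
  have q: "simple_function N q"
    unfolding q_def by (rule N.simple_function_membership[OF R(1)]) (rule cylN)
  let ?U = "\<Union>A\<in>R. sym_diff A (cyl A)"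
  have U: "?U \<in> sets N" using R RN cylN by auto
  have "measure N ?U \<le> (\<Sum>A\<in>R. measure N (sym_diff A (cyl A)))"
    using R(1) RN cylN by (intro measure_UNION_le) auto
  also have "\<dots> \<le> (\<Sum>A\<in>R. e2)"
    using cyl(2) by (intro sum_mono less_imp_le)
  finally have mU: "measure N ?U \<le> card R * e2" by simp
  have qU: "y \<in> ?U" if "q y \<noteq> q' y" for y
    using that by (auto simp: q_def q'_def)
  have qE: "q y = q z"
    if yz: "y \<in> space N" "z \<in> space N" "\<And>h. h \<in> (\<Union>A\<in>R. E A) \<Longrightarrow> y h = z h" for y z
  proof -
    have "y \<in> cyl A \<longleftrightarrow> z \<in> cyl A" if "A \<in> R" for A
    proof (rule determinesD[OF _ yz(1,2)])
      show "determines N (\<lambda>h y. y h) (E A) (cyl A)" using E that by simp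
      show "y h = z h" if "h \<in> E A" for h using yz(3) that \<open>A \<in> R\<close> by blast
    qed
    then show ?thesis by (auto simp: q_def)
  qed

  \<comment> \<open>The guess contains \<open>p\<close> if some point of \<open>D p\<close> has the
    itinerary \<open>w\<close>. For a true itinerary every point having it gives the same answer,
    because \<open>D p\<close> is determined by questions from \<open>F\<close> and
    \<open>R\<close>; for other \<open>w\<close> the definition still yields a value.\<close>
  define f where "f w = {p \<in> P. \<exists>y\<in>space N. y \<in> D p \<and> (\<forall>s\<in>F. \<forall>A\<in>R. act s y \<in> A \<longleftrightarrow> A \<in> w s)}" for w
  have f: "f (\<lambda>s\<in>F. q' (act s y)) = {p \<in> P. y \<in> D p}" if y: "y \<in> space N" for y
  proof (intro Set.set_eqI iffI)
    fix p assume "p \<in> f (\<lambda>s\<in>F. q' (act s y))"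
    then obtain z where p: "p \<in> P" and z: "z \<in> space N" "z \<in> D p"
      "\<forall>s\<in>F. \<forall>A\<in>R. act s z \<in> A \<longleftrightarrow> A \<in> (\<lambda>s\<in>F. q' (act s y)) s"
      by (auto simp: f_def)
    have "z \<in> D p \<longleftrightarrow> y \<in> D p"
    proof (rule determinesD[OF _ z(1) y])
      show "determines N (\<lambda>i y. act (fst i) y \<in> snd i) (W p) (D p)" using W p by simp
      fix i assume "i \<in> W p"
      then have "fst i \<in> F" "snd i \<in> R" using FR[OF p, of "fst i" "snd i"] by simp_all
      then show "(act (fst i) z \<in> snd i) = (act (fst i) y \<in> snd i)" using z(3) by (simp add: q'_def)
    qed
    then show "p \<in> {p \<in> P. y \<in> D p}" using z p by simp
  next
    fix p assume "p \<in> {p \<in> P. y \<in> D p}"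
    then have "p \<in> P" "y \<in> D p" by simp_all
    then show "p \<in> f (\<lambda>s\<in>F. q' (act s y))"
      unfolding f_def using y by (intro CollectI conjI bexI[of _ y]) (simp_all add: q'_def)
  qed
  let ?Z = "{y \<in> space N. ?pl (y \<one>) \<noteq> f (\<lambda>s\<in>F. q (act s y))}"
  \<comment> \<open>The two sources of a wrong guess: \<open>D p\<close> misjudges the coordinate at
    the identity, or some translate of the point lies where \<open>q\<close> and \<open>q'\<close>
    may differ.\<close>
  let ?V = "(\<Union>p\<in>P. sym_diff (?B p) (D p)) \<union> (\<Union>s\<in>F. act s -` ?U \<inter> space N)"
  have DN: "D p \<in> sets N" if "p \<in> P" for p
    using D(1)[OF that] finitary_subset_sets by blast
  have V1: "(\<Union>p\<in>P. sym_diff (?B p) (D p)) \<in> sets N"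
    using P(1) B DN by (intro sets.finite_UN sets.Un sets.Diff) auto
  have aU: "act s -` ?U \<inter> space N \<in> sets N" if "s \<in> F" for s
    using that F U by (intro measurable_sets[OF act_measurable]) auto
  have V2: "(\<Union>s\<in>F. act s -` ?U \<inter> space N) \<in> sets N"
    using F(1) aU by (intro sets.finite_UN) auto
  have "?Z \<subseteq> ?V"
  proof (rule subsetI, rule ccontr)
    fix y assume y: "y \<in> ?Z" and n: "y \<notin> ?V"
    have yN: "y \<in> space N" using y by simp
    have "q (act s y) = q' (act s y)" if "s \<in> F" for s
      using n yN that qU[of "act s y"] by blast
    then have "f (\<lambda>s\<in>F. q (act s y)) = f (\<lambda>s\<in>F. q' (act s y))"
      by (intro arg_cong[where f = f] restrict_ext)
    also have "\<dots> = {p \<in> P. y \<in> D p}" by (rule f[OF yN])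
    also have "\<dots> = ?pl (y \<one>)" using n yN by auto
    finally show False using y by simp
  qed
  then have "measure N ?Z \<le> measure N ?V"
    by (rule N.finite_measure_mono[OF _ sets.Un[OF V1 V2]])
  also have "\<dots> \<le> measure N (\<Union>p\<in>P. sym_diff (?B p) (D p)) + measure N (\<Union>s\<in>F. act s -` ?U \<inter> space N)"
    by (rule measure_Un_le[OF V1 V2])
  also have "measure N (\<Union>p\<in>P. sym_diff (?B p) (D p)) \<le> (\<Sum>p\<in>P. measure N (sym_diff (?B p) (D p)))"
    using P(1) B DN by (intro measure_UNION_le) auto
  also have "\<dots> \<le> (\<Sum>p\<in>P. e1)"
    using D(2) by (intro sum_mono less_imp_le)
  also have "\<dots> = card P * e1" by simp
  also have "measure N (\<Union>s\<in>F. act s -` ?U \<inter> space N) \<le> (\<Sum>s\<in>F. measure N (act s -` ?U \<inter> space N))"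
    using F(1) aU by (intro measure_UNION_le) auto
  also have "\<dots> = (\<Sum>s\<in>F. measure N ?U)"
    using F(2) U by (intro sum.cong refl measure_act) auto
  also have "\<dots> \<le> card F * (card R * e2)"
    using mU by (simp add: mult_left_mono)
  finally have mZ: "measure N ?Z \<le> card P * e1 + card F * (card R * e2)"
    by this simp_all
  have "4 * m\<^sup>2 * measure N ?Z \<le> 4 * m\<^sup>2 * (card P * e1 + card F * (card R * e2))"
    using mZ by (intro mult_left_mono) auto
  also have "\<dots> = 4 * m\<^sup>2 * (card P * e1) + 4 * ((m\<^sup>2 * card F) * (card R * e2))"
    by (simp add: algebra_simps)
  also have "\<dots> \<le> 1"
    using e1(2) e2[OF _ L(2)] by simp
  finally have small: "4 * m\<^sup>2 * measure N ?Z \<le> 1" .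

  have "shannon M ?pl \<le> shannon N q + 3"
  proof (rule shannon_le_sofic_model[OF sofic _ q _ _ qE F])
    show "simple_function M ?pl"
      using P by (intro M.simple_function_membership) auto
    show "finite (\<Union>A\<in>R. E A)" "(\<Union>A\<in>R. E A) \<subseteq> carrier G"
      using R(1) E by auto
    show "4 * (real (card (?pl ` space M)))\<^sup>2 * measure N ?Z \<le> 1"
      using small by (simp add: m_def)
  qed
  also have "shannon N q \<le> shannon N q' + 2"
  proof (rule N.shannon_perturb_le[OF q q'])
    show "finite (Pow R)" "q ` space N \<subseteq> Pow R" using R(1) by (auto simp: q_def)
    have "measure N {y \<in> space N. q y \<noteq> q' y} \<le> measure N ?U"
      using U qU by (intro N.finite_measure_mono) auto
    then show "measure N {y \<in> space N. q y \<noteq> q' y} \<le> card R * e2" using mU by linarith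
    show "4 * (real (card (Pow R)))\<^sup>2 * (card R * e2) \<le> 1"
      using e2[OF _ L(3)] by simp
  qed
  also have "shannon N q' \<le> (\<Sum>A\<in>R. eta (measure N A)) + 1"
    unfolding q'_def
  proof (rule N.shannon_disjoint_membership_le(1)[OF R(1)])
    show "disjoint R" using QN(2) R(2) by (rule pairwise_subset)
    show "\<Union>R \<subseteq> space N" using R(2) QN(3) by blast
  qed
  also have "(\<Sum>A\<in>R. eta (measure N A)) \<le> c"
    by (rule sum_eta_le_partition_entropy[OF N.prob_space_axioms R Q(2,3)])
  finally show ?thesis by simp
qed

end

theorem theorem2p6:
  fixes G :: "('g, 'm) monoid_scheme" and M :: "'a measure"
  assumes "group G"
    and "countable (carrier G)"
    and "sofic G"
    and "standard_prob_space M"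
    and "space_entropy M = \<infinity>"
  shows "\<not> (\<exists>Q. generating_partition G (bernoulli_action G) (bernoulli_space G M) Q \<and>
                partition_entropy (bernoulli_space G M) Q < \<infinity>)"
proof
  assume "\<exists>Q. generating_partition G (bernoulli_action G) (bernoulli_space G M) Q \<and>
    partition_entropy (bernoulli_space G M) Q < \<infinity>"
  then obtain Q where Q: "generating_partition G (bernoulli_action G) (bernoulli_space G M) Q"
    "partition_entropy (bernoulli_space G M) Q < \<infinity>" by auto
  interpret bernoulli_shift G M
    using assms by (intro bernoulli_shift.intro) (auto simp: standard_prob_space_def)
  obtain c where c: "partition_entropy N Q = ennreal c" "0 \<le> c"
    using Q(2) by (cases "partition_entropy N Q") auto
  \<comment> \<open>A bound uniform in the finite partition \<open>P\<close> contradicts the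
    infinite supremum. The entropy of \<open>P\<close> is rewritten as that of its membership label,
    to which the preceding estimate applies.\<close>
  have "partition_entropy M P \<le> ennreal (c + 6)"
    if P: "finite P" "countable_measurable_partition M P" for P
  proof -
    have P': "P \<subseteq> sets M" "disjoint P" "\<Union>P = space M" "{} \<notin> P"
      using P(2) by (auto simp: countable_measurable_partition_def partition_on_def)
    have "partition_entropy M P = (\<Sum>A\<in>P. ennreal (eta (measure M A)))"
      using P(1) by (simp add: partition_entropy_def eta_def)
    also have "\<dots> = ennreal (\<Sum>A\<in>P. eta (measure M A))"
      by (intro sum_ennreal eta_nonneg) auto
    also have "(\<Sum>A\<in>P. eta (measure M A)) = shannon M (\<lambda>x. {p \<in> P. x \<in> p})"
      using P(1) P' by (intro M.shannon_disjoint_membership_le(2)[symmetric]) auto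
    also have "\<dots> \<le> c + 6"
      using shannon_le_partition_entropy[OF assms(3) Q(1) _ c(2) P(1) P'(1)] c(1) by simp
    finally show ?thesis by (simp add: ennreal_leI)
  qed
  then have "space_entropy M \<le> ennreal (c + 6)"
    unfolding space_entropy_def by (intro SUP_least) auto
  then show False using assms(5) by (simp add: top_unique)
qed

end
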